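(* Let $K$ be a field, let $A=K[a_1,\dots,a_m]$ be trivially graded, let $P=A[x_1,\dots,x_k]$ be positively graded by $W=(w_1,\dots,w_k)$, and let $R=P/I$ be a positive $A$-algebra. (a) Let $\Gamma=(\gamma_1,\dots,\gamma_m)\in K^m$ be a base point and $\Gamma_0=(\gamma_1,\dots,\gamma_m,0,\dots,0)$ the zero point over $\Gamma$. Assume that $\Pi=(\gamma_1,\dots,\gamma_m,\pi_1,\dots,\pi_k)$ is a $K$-rational point on the fiber $F_\Gamma$ with $(\pi_1,\dots,\pi_k)\neq(0,\dots,0)$. Furthermore, let $t$ be a new indeterminate, and let $\psi: K[X]\to K[t]$ be the $K$-algebra homomorphism defined by $\psi(x_i)=\pi_i\,t^{w_i}$ for $i=1,\dots,k$. Then the kernel of $\psi$ defines an irreducible curve $C_{\Pi,\Gamma_0}\subseteq\mathbb{A}^k_K$ which is contained in $F_\Gamma$ and which contains both points $\Pi$ and $\Gamma_0$. (b) For every $\Gamma\in K^m$, the fiber $F_\Gamma$ of $\Theta$ is connected. (c) The scheme $\operatorname{Spec}(R)$ is connected.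
   Context: $A=K[a_1,\dots,a_m]$ is a polynomial ring over the field $K$, and $P=A[x_1,\dots,x_k]$ is graded by $\deg(a_i)=0$ and $\deg(x_j)=w_j$, with positive integers $w_j$; write $X=\{x_1,\dots,x_k\}$, so that $K[X]=K[x_1,\dots,x_k]$, and $n=m+k$. A positive $A$-algebra is a ring $R=P/I$ where $I$ is a $W$-homogeneous ideal of $P$ with $I\cap A=\{0\}$ (hence $I\subseteq\langle x_1,\dots,x_k\rangle$). The canonical morphism $\Theta:\operatorname{Spec}(R)\to\mathbb{A}^m_K=\operatorname{Spec}(A)$ is induced by the inclusion $A\to R$. For $\Gamma=(\gamma_1,\dots,\gamma_m)\in K^m$, the fiber of $\Theta$ over $\Gamma$ is the closed subscheme $F_\Gamma=\Theta^{-1}(\Gamma)$ of $\operatorname{Spec}(R)$; its coordinate ring is $K[X]/I_\Gamma$, where $I_\Gamma$ is the image of $I$ under $P\to K[X]$, $a_i\mapsto\gamma_i$, $x_j\mapsto x_j$, and in this way $F_\Gamma$ is viewed as a closed subscheme of $\mathbb{A}^k_K$. Under this identification the points $\Pi$ and $\Gamma_0$ of $F_\Gamma$ correspond to $(\pi_1,\dots,\pi_k)$ and $(0,\dots,0)$ in $K^k$. *)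

theory Defs
  imports
    "HOL-Analysis.Abstract_Topology"
    "HOL-Algebra.QuotRing"
    "HOL-Library.Poly_Mapping"
    "HOL-Library.Extended_Nat"
    "HOL-Computational_Algebra.Polynomial"
begin

section \<open>Prime spectra\<close>

definition Spec :: "('a, 'b) ring_scheme \<Rightarrow> 'a set set" where
  "Spec R = {p. primeideal p R}"

definition zero_locus :: "('a, 'b) ring_scheme \<Rightarrow> 'a set \<Rightarrow> 'a set set" where
  "zero_locus R S = {p \<in> Spec R. S \<subseteq> p}"

definition zariski :: "('a, 'b) ring_scheme \<Rightarrow> 'a set topology" where
  "zariski R = topology (\<lambda>U. \<exists>S \<subseteq> carrier R. U = Spec R - zero_locus R S)"

lemma zero_locus_Un: "zero_locus R (\<Union>\<S>) = {p \<in> Spec R. \<forall>S\<in>\<S>. p \<in> zero_locus R S}"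
  by (auto simp: zero_locus_def)

lemma zero_locus_mult:
  assumes "S \<subseteq> carrier R" "T \<subseteq> carrier R"
  shows "zero_locus R {s \<otimes>\<^bsub>R\<^esub> t | s t. s \<in> S \<and> t \<in> T} = zero_locus R S \<union> zero_locus R T"
proof (intro equalityI subsetI)
  fix p assume p: "p \<in> zero_locus R {s \<otimes>\<^bsub>R\<^esub> t | s t. s \<in> S \<and> t \<in> T}"
  then interpret primeideal p R by (simp add: zero_locus_def Spec_def)
  have "S \<subseteq> p \<or> T \<subseteq> p"
  proof (rule ccontr)
    assume "\<not> (S \<subseteq> p \<or> T \<subseteq> p)"
    then obtain s t where st: "s \<in> S" "s \<notin> p" "t \<in> T" "t \<notin> p" by blast
    then have "s \<otimes>\<^bsub>R\<^esub> t \<in> p" using p by (auto simp: zero_locus_def)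
    then show False using I_prime[of s t] st assms by blast
  qed
  then show "p \<in> zero_locus R S \<union> zero_locus R T"
    using p by (auto simp: zero_locus_def)
next
  fix p assume p: "p \<in> zero_locus R S \<union> zero_locus R T"
  then interpret primeideal p R by (auto simp: zero_locus_def Spec_def)
  show "p \<in> zero_locus R {s \<otimes>\<^bsub>R\<^esub> t | s t. s \<in> S \<and> t \<in> T}"
    using p assms I_l_closed I_r_closed by (auto simp: zero_locus_def subset_iff)
qed

lemma istopology_zariski:
  "istopology (\<lambda>U. \<exists>S \<subseteq> carrier R. U = Spec R - zero_locus R S)"
  unfolding istopology_def
proof (intro conjI allI impI)
  fix U V
  assume "\<exists>S\<subseteq>carrier R. U = Spec R - zero_locus R S"
    and "\<exists>S\<subseteq>carrier R. V = Spec R - zero_locus R S"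
  then obtain S T where
    S: "S \<subseteq> carrier R" "U = Spec R - zero_locus R S" and
    T: "T \<subseteq> carrier R" "V = Spec R - zero_locus R T" by blast
  show "\<exists>S\<subseteq>carrier R. U \<inter> V = Spec R - zero_locus R S"
  proof (cases "Spec R = {}")
    case True
    then show ?thesis using S by auto
  next
    case False
    then obtain p where "primeideal p R" by (auto simp: Spec_def)
    then interpret primeideal p R .
    have "{s \<otimes>\<^bsub>R\<^esub> t | s t. s \<in> S \<and> t \<in> T} \<subseteq> carrier R"
      using S(1) T(1) by (auto simp: subset_iff)
    moreover have "U \<inter> V = Spec R - zero_locus R {s \<otimes>\<^bsub>R\<^esub> t | s t. s \<in> S \<and> t \<in> T}"
      unfolding zero_locus_mult[OF S(1) T(1)] S(2) T(2) by auto
    ultimately show ?thesis by blast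
  qed
next
  fix \<U> assume "\<forall>U\<in>\<U>. \<exists>S\<subseteq>carrier R. U = Spec R - zero_locus R S"
  then obtain S where S: "\<And>U. U \<in> \<U> \<Longrightarrow> S U \<subseteq> carrier R \<and> U = Spec R - zero_locus R (S U)"
    by metis
  have "\<Union>\<U> = Spec R - zero_locus R (\<Union>(S ` \<U>))"
  proof -
    have "\<Union>\<U> = (\<Union>U\<in>\<U>. Spec R - zero_locus R (S U))"
      using S by (metis (no_types, lifting) SUP_cong image_ident)
    then show ?thesis by (auto simp: zero_locus_Un)
  qed
  moreover have "\<Union>(S ` \<U>) \<subseteq> carrier R" using S by blast
  ultimately show "\<exists>S\<subseteq>carrier R. \<Union>\<U> = Spec R - zero_locus R S" by blast
qed

lemma openin_zariski:
  "openin (zariski R) U \<longleftrightarrow> (\<exists>S \<subseteq> carrier R. U = Spec R - zero_locus R S)"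
  by (simp add: zariski_def topology_inverse'[OF istopology_zariski])

lemma topspace_zariski: "topspace (zariski R) = Spec R"
proof
  show "topspace (zariski R) \<subseteq> Spec R"
    unfolding topspace_def openin_zariski by blast
  have "zero_locus R (carrier R) = {}"
  proof -
    have False if "primeideal p R" "carrier R \<subseteq> p" for p
    proof -
      interpret primeideal p R by fact
      have "p \<subseteq> carrier R" by (rule a_subset)
      then show False using that(2) I_notcarr by simp
    qed
    then show ?thesis by (auto simp: zero_locus_def Spec_def)
  qed
  then have "openin (zariski R) (Spec R)"
    unfolding openin_zariski by (intro exI[of _ "carrier R"]) simp
  then show "Spec R \<subseteq> topspace (zariski R)" by (rule openin_subset)
qed

text \<open>The map of spectra induced by a ring homomorphism \<open>h\<close> defined on \<open>R\<close>.\<close>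

definition Spec_map :: "('a, 'b) ring_scheme \<Rightarrow> ('a \<Rightarrow> 'c) \<Rightarrow> 'c set \<Rightarrow> 'a set" where
  "Spec_map R h q = {r \<in> carrier R. h r \<in> q}"

section \<open>Connectedness, irreducibility and dimension\<close>

text \<open>A connected scheme is understood to be nonempty, whereas \<^const>\<open>connected_space\<close>
  admits the empty space.\<close>

definition connected_nonempty :: "'a topology \<Rightarrow> bool" where
  "connected_nonempty T \<longleftrightarrow> topspace T \<noteq> {} \<and> connected_space T"

definition irreducible_in :: "'a topology \<Rightarrow> 'a set \<Rightarrow> bool" where
  "irreducible_in T Z \<longleftrightarrow> Z \<noteq> {} \<and> Z \<subseteq> topspace T \<and>
     (\<forall>C D. closedin T C \<longrightarrow> closedin T D \<longrightarrow> Z \<subseteq> C \<union> D \<longrightarrow> Z \<subseteq> C \<or> Z \<subseteq> D)"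

text \<open>The supremum of the lengths \<open>n\<close> of strictly increasing chains
  \<open>Z 0 \<subset> Z 1 \<subset> \<dots> \<subset> Z n\<close> of irreducible closed subsets.
  The empty space gets dimension \<open>0\<close>.\<close>

definition krull_dim :: "'a topology \<Rightarrow> enat" where
  "krull_dim T = Sup {enat n | n. \<exists>Z :: nat \<Rightarrow> 'a set.
     (\<forall>i\<le>n. closedin T (Z i) \<and> irreducible_in T (Z i)) \<and> (\<forall>i<n. Z i \<subset> Z (Suc i))}"

definition irreducible_curve :: "'a topology \<Rightarrow> 'a set \<Rightarrow> bool" where
  "irreducible_curve T C \<longleftrightarrow>
     closedin T C \<and> irreducible_in T C \<and> krull_dim (subtopology T C) = 1"

section \<open>Polynomial rings\<close>

text \<open>\<open>AVar i\<close> and \<open>XVar j\<close> stand for \<open>a\<^sub>i\<close> and \<open>x\<^sub>j\<close>. All polynomial rings in question are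
  realised inside one type, as the polynomials involving only variables from a given set.\<close>

datatype var = AVar nat | XVar nat

type_synonym 'k mpoly = "(var \<Rightarrow>\<^sub>0 nat) \<Rightarrow>\<^sub>0 'k"

definition mpoly_ring :: "var set \<Rightarrow> 'k::field mpoly ring" where
  "mpoly_ring V = \<lparr>carrier = {p. \<forall>\<mu> \<in> Poly_Mapping.keys p. Poly_Mapping.keys \<mu> \<subseteq> V},
     monoid.mult = (*), one = 1, zero = 0, add = (+)\<rparr>"

lemma cring_mpoly_ring: "cring (mpoly_ring V :: 'k::field mpoly ring)" (is "cring ?R")
proof (rule cringI)
  show "abelian_group ?R"
  proof (rule abelian_groupI)
    fix p q assume "p \<in> carrier ?R" "q \<in> carrier ?R"
    then show "p \<oplus>\<^bsub>?R\<^esub> q \<in> carrier ?R"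
      using Poly_Mapping.keys_add[of p q] by (auto simp: mpoly_ring_def)
  next
    fix p assume "p \<in> carrier ?R"
    then show "\<exists>q\<in>carrier ?R. q \<oplus>\<^bsub>?R\<^esub> p = \<zero>\<^bsub>?R\<^esub>"
      by (intro bexI[of _ "- p"]) (auto simp: mpoly_ring_def in_keys_iff)
  qed (simp_all add: mpoly_ring_def algebra_simps)
  show "Group.comm_monoid ?R"
  proof (rule comm_monoidI)
    fix p q assume pq: "p \<in> carrier ?R" "q \<in> carrier ?R"
    have "Poly_Mapping.keys \<rho> \<subseteq> V" if \<rho>_key: "\<rho> \<in> Poly_Mapping.keys (p * q)" for \<rho>
    proof -
      obtain \<mu> \<nu> where \<rho>: "\<rho> = \<mu> + \<nu>"
        and "\<mu> \<in> Poly_Mapping.keys p" "\<nu> \<in> Poly_Mapping.keys q"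
        using \<rho>_key Poly_Mapping.keys_mult[of p q] by blast
      then have "Poly_Mapping.keys \<mu> \<subseteq> V" "Poly_Mapping.keys \<nu> \<subseteq> V"
        using pq by (simp_all add: mpoly_ring_def)
      then show ?thesis
        using Poly_Mapping.keys_add[of \<mu> \<nu>] unfolding \<rho> by blast
    qed
    then show "p \<otimes>\<^bsub>?R\<^esub> q \<in> carrier ?R"
      by (simp add: mpoly_ring_def)
  qed (simp_all add: mpoly_ring_def algebra_simps)
qed (simp add: mpoly_ring_def algebra_simps)

definition avars :: "nat \<Rightarrow> var set" where
  "avars m = AVar ` {1..m}"

definition xvars :: "nat \<Rightarrow> var set" where
  "xvars k = XVar ` {1..k}"

abbreviation ring_A :: "nat \<Rightarrow> 'k::field mpoly ring" where
  "ring_A m \<equiv> mpoly_ring (avars m)"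

abbreviation ring_P :: "nat \<Rightarrow> nat \<Rightarrow> 'k::field mpoly ring" where
  "ring_P m k \<equiv> mpoly_ring (avars m \<union> xvars k)"

abbreviation ring_KX :: "nat \<Rightarrow> 'k::field mpoly ring" where
  "ring_KX k \<equiv> mpoly_ring (xvars k)"

text \<open>Substitution of \<open>s v\<close> for each variable \<open>v\<close>, with \<open>c\<close> applied to the coefficients:
  if \<open>c\<close> is a ring homomorphism, this is the induced ring homomorphism.\<close>

definition mpoly_subst ::
    "('k::zero \<Rightarrow> 'b::comm_semiring_1) \<Rightarrow> (var \<Rightarrow> 'b) \<Rightarrow> 'k mpoly \<Rightarrow> 'b" where
  "mpoly_subst c s p = (\<Sum>\<mu> \<in> Poly_Mapping.keys p.
     c (Poly_Mapping.lookup p \<mu>) *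
       (\<Prod>v \<in> Poly_Mapping.keys \<mu>. s v ^ Poly_Mapping.lookup \<mu> v))"

definition mpoly_const :: "'k::zero \<Rightarrow> 'k mpoly" where
  "mpoly_const c = Poly_Mapping.single 0 c"

definition mpoly_var :: "var \<Rightarrow> 'k::zero_neq_one mpoly" where
  "mpoly_var v = Poly_Mapping.single (Poly_Mapping.single v 1) 1"

text \<open>The \<open>K\<close>-rational point of affine space with coordinates \<open>c\<close>, as a maximal ideal.\<close>

definition rational_point :: "var set \<Rightarrow> (var \<Rightarrow> 'k::field) \<Rightarrow> 'k mpoly set" where
  "rational_point V c = {f \<in> carrier (mpoly_ring V). mpoly_subst id c f = 0}"

text \<open>Tuples in \<open>K\<^sup>m\<close> and \<open>K\<^sup>k\<close> are functions on the natural numbers of which only the values on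
  \<open>{1..m}\<close> resp. \<open>{1..k}\<close> matter.\<close>

definition base_point :: "nat \<Rightarrow> (nat \<Rightarrow> 'k::field) \<Rightarrow> 'k mpoly set" where
  "base_point m \<gamma> = rational_point (avars m) (case_var \<gamma> (\<lambda>_. 0))"

definition fiber_point :: "nat \<Rightarrow> (nat \<Rightarrow> 'k::field) \<Rightarrow> 'k mpoly set" where
  "fiber_point k \<pi> = rational_point (xvars k) (case_var (\<lambda>_. 0) \<pi>)"

section \<open>Positive algebras and their fibers\<close>

definition wdeg :: "(nat \<Rightarrow> nat) \<Rightarrow> (var \<Rightarrow>\<^sub>0 nat) \<Rightarrow> nat" where
  "wdeg w \<mu> = (\<Sum>v \<in> Poly_Mapping.keys \<mu>. Poly_Mapping.lookup \<mu> v * case_var (\<lambda>_. 0) w v)"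

definition hom_component :: "(nat \<Rightarrow> nat) \<Rightarrow> nat \<Rightarrow> 'k::comm_monoid_add mpoly \<Rightarrow> 'k mpoly" where
  "hom_component w d f = (\<Sum>\<mu> \<in> {\<mu> \<in> Poly_Mapping.keys f. wdeg w \<mu> = d}.
     Poly_Mapping.single \<mu> (Poly_Mapping.lookup f \<mu>))"

definition homogeneous_ideal ::
    "nat \<Rightarrow> nat \<Rightarrow> (nat \<Rightarrow> nat) \<Rightarrow> 'k::field mpoly set \<Rightarrow> bool" where
  "homogeneous_ideal m k w I \<longleftrightarrow>
     ideal I (ring_P m k) \<and> (\<forall>f\<in>I. \<forall>d. hom_component w d f \<in> I)"

text \<open>\<open>ring_P m k Quot I\<close> is a positive \<open>A\<close>-algebra.\<close>

definition positive_algebra ::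
    "nat \<Rightarrow> nat \<Rightarrow> (nat \<Rightarrow> nat) \<Rightarrow> 'k::field mpoly set \<Rightarrow> bool" where
  "positive_algebra m k w I \<longleftrightarrow>
     (\<forall>j\<in>{1..k}. 0 < w j) \<and> homogeneous_ideal m k w I \<and> I \<inter> carrier (ring_A m) = {0}"

definition ring_R :: "nat \<Rightarrow> nat \<Rightarrow> 'k::field mpoly set \<Rightarrow> 'k mpoly set ring" where
  "ring_R m k I = ring_P m k Quot I"

text \<open>The morphism from \<open>Spec R\<close> to \<open>Spec A\<close>, induced by \<open>A \<subseteq> P \<rightarrow> R\<close>.\<close>

definition Theta :: "nat \<Rightarrow> nat \<Rightarrow> 'k::field mpoly set \<Rightarrow> 'k mpoly set set \<Rightarrow> 'k mpoly set" where
  "Theta m k I = Spec_map (ring_A m) (\<lambda>f. I +>\<^bsub>ring_P m k\<^esub> f)"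

definition fiber_Spec ::
    "nat \<Rightarrow> nat \<Rightarrow> 'k::field mpoly set \<Rightarrow> (nat \<Rightarrow> 'k) \<Rightarrow> 'k mpoly set set set" where
  "fiber_Spec m k I \<gamma> = {q \<in> Spec (ring_R m k I). Theta m k I q = base_point m \<gamma>}"

text \<open>The same fiber as a closed subscheme of \<open>\<bbbA>\<^sup>k\<close>: the defining ideal \<open>I\<^sub>\<Gamma>\<close>, the image of \<open>I\<close> under
  \<open>a\<^sub>i \<mapsto> \<gamma>\<^sub>i\<close>, \<open>x\<^sub>j \<mapsto> x\<^sub>j\<close>, and the underlying set.\<close>

definition fiber_ideal :: "'k::field mpoly set \<Rightarrow> (nat \<Rightarrow> 'k) \<Rightarrow> 'k mpoly set" where
  "fiber_ideal I \<gamma> =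
     mpoly_subst mpoly_const (case_var (\<lambda>i. mpoly_const (\<gamma> i)) (\<lambda>j. mpoly_var (XVar j))) ` I"

definition fiber_affine ::
    "nat \<Rightarrow> 'k::field mpoly set \<Rightarrow> (nat \<Rightarrow> 'k) \<Rightarrow> 'k mpoly set set" where
  "fiber_affine k I \<gamma> = zero_locus (ring_KX k) (fiber_ideal I \<gamma>)"

section \<open>The curve\<close>

text \<open>The value at \<open>AVar i\<close> is irrelevant, as \<open>psi\<close> is only applied to elements of \<open>K[X]\<close>.\<close>

definition psi :: "(nat \<Rightarrow> nat) \<Rightarrow> (nat \<Rightarrow> 'k::field) \<Rightarrow> 'k mpoly \<Rightarrow> 'k poly" where
  "psi w \<pi> = mpoly_subst (\<lambda>c. [:c:]) (case_var (\<lambda>_. 0) (\<lambda>j. Polynomial.monom (\<pi> j) (w j)))"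

definition psi_kernel :: "nat \<Rightarrow> (nat \<Rightarrow> nat) \<Rightarrow> (nat \<Rightarrow> 'k::field) \<Rightarrow> 'k mpoly set" where
  "psi_kernel k w \<pi> = {f \<in> carrier (ring_KX k). psi w \<pi> f = 0}"

definition curve :: "nat \<Rightarrow> (nat \<Rightarrow> nat) \<Rightarrow> (nat \<Rightarrow> 'k::field) \<Rightarrow> 'k mpoly set set" where
  "curve k w \<pi> = zero_locus (ring_KX k) (psi_kernel k w \<pi>)"

end

theory Submission
  imports Defs
begin

text \<open>
  The weights define a contraction. Replacing \<open>x\<^sub>j\<close> by \<open>t^(w j) x\<^sub>j\<close> moves a point of \<open>Spec R\<close> along a curve
  inside its fiber over \<open>Spec A\<close>, and for \<open>t = 0\<close> it arrives on the zero section. This stays inside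
  \<open>Spec R\<close> because \<open>I\<close> is homogeneous, and the zero section belongs to \<open>Spec R\<close> because \<open>I \<inter> A = 0\<close>.

  For arbitrary primes, rational or not, the contraction takes the following form. Given a prime
  \<open>p \<supseteq> I\<close>, the polynomials all of whose homogeneous components lie in \<open>p\<close> form a prime \<open>p*\<close>
  (\<open>primeideal_homogeneous_core\<close>), and those whose component of degree \<open>0\<close> lies in \<open>p\<close> form a prime \<open>p\<^sub>0\<close>
  on the zero section. Both contain \<open>I\<close> and have the same intersection with \<open>A\<close> as \<open>p\<close>
  (\<open>contraction_of_prime\<close>), and \<open>p \<supseteq> p* \<subseteq> p\<^sub>0\<close>; so the irreducible set of primes above \<open>p*\<close> joins
  \<open>p\<close> to the zero section. The part of the zero section in question is irreducible: a single point for a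
  fiber, and a copy of \<open>Spec A\<close> for \<open>Spec R\<close>. Connectedness follows from
  \<open>connected_by_specializations\<close>.

  For a rational point \<open>\<Pi>\<close> of the fiber, \<open>p*\<close> is the kernel of \<open>psi\<close>, since the coefficients of
  \<open>psi w \<pi> f\<close> are the values at \<open>\<pi>\<close> of the components of \<open>f\<close>. This gives the inclusions and incidences
  claimed for the curve. It is irreducible, as \<open>psi\<close> maps to a domain. Its dimension is one because the
  image of \<open>psi\<close> is a subalgebra \<open>B \<noteq> K\<close> of \<open>K[t]\<close> spanned by powers of \<open>t\<close>: for nonzero \<open>b\<close> in \<open>B\<close> a
  count of exponents shows that \<open>B/(b)\<close> is finite-dimensional over \<open>K\<close>
  (\<open>algebraic_modulo_principal_ideal\<close>), and therefore every nonzero prime of \<open>B\<close> is maximal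
  (\<open>no_chain_above_psi_kernel\<close>).
\<close>

section \<open>Substitution homomorphisms and the grading\<close>

text \<open>Evaluation at a point, specialization of the \<open>a\<^sub>i\<close>, \<open>psi\<close> and homogenization all are
  substitutions. Treating each of them as a unital ring homomorphism between types lets them be
  composed by comparing coefficients and variables only.\<close>

locale unital_hom =
  fixes h :: "'a::comm_ring_1 \<Rightarrow> 'b::comm_ring_1"
  assumes hom_one: "h 1 = 1"
    and hom_add: "h (x + y) = h x + h y"
    and hom_mult: "h (x * y) = h x * h y"
begin

lemma hom_zero: "h 0 = 0"
  using hom_add[of 0 0] by simp

lemma hom_sum: "h (sum f S) = (\<Sum>x\<in>S. h (f x))"
  by (induction S rule: infinite_finite_induct) (simp_all add: hom_zero hom_add)

lemma hom_prod: "h (prod f S) = (\<Prod>x\<in>S. h (f x))"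
  by (induction S rule: infinite_finite_induct) (simp_all add: hom_one hom_mult)

lemma hom_power: "h (x ^ n) = h x ^ n"
  by (induction n) (simp_all add: hom_one hom_mult)

end

lemma unital_hom_comp:
  assumes "unital_hom g" "unital_hom h"
  shows "unital_hom (\<lambda>x. g (h x))"
proof -
  interpret g: unital_hom g by fact
  interpret h: unital_hom h by fact
  show ?thesis
    by unfold_locales
      (simp_all add: g.hom_one g.hom_add g.hom_mult h.hom_one h.hom_add h.hom_mult)
qed

lemma unital_hom_id: "unital_hom id"
  by unfold_locales simp_all

lemma unital_hom_pconst: "unital_hom (\<lambda>a. [:a:])"
  by unfold_locales simp_all

lemma unital_hom_mpoly_const: "unital_hom mpoly_const"
  by unfold_locales (simp_all add: mpoly_const_def single_add mult_single)

lemma unital_hom_poly: "unital_hom (\<lambda>q. poly q a)"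
  by unfold_locales simp_all

definition monomial_value :: "(var \<Rightarrow> 'b::comm_semiring_1) \<Rightarrow> (var \<Rightarrow>\<^sub>0 nat) \<Rightarrow> 'b" where
  "monomial_value s \<mu> = (\<Prod>v \<in> Poly_Mapping.keys \<mu>. s v ^ Poly_Mapping.lookup \<mu> v)"

lemma monomial_value_superset:
  assumes "finite M" "Poly_Mapping.keys \<mu> \<subseteq> M"
  shows "monomial_value s \<mu> = (\<Prod>v \<in> M. s v ^ Poly_Mapping.lookup \<mu> v)"
  unfolding monomial_value_def using assms
  by (intro prod.mono_neutral_left) (auto simp: in_keys_iff)

lemma monomial_value_add: "monomial_value s (\<mu> + \<nu>) = monomial_value s \<mu> * monomial_value s \<nu>"
proof -
  let ?M = "Poly_Mapping.keys \<mu> \<union> Poly_Mapping.keys \<nu>"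
  have "monomial_value s \<kappa> = (\<Prod>v \<in> ?M. s v ^ Poly_Mapping.lookup \<kappa> v)"
    if "\<kappa> \<in> {\<mu>, \<nu>, \<mu> + \<nu>}" for \<kappa>
    using that Poly_Mapping.keys_add[of \<mu> \<nu>] by (intro monomial_value_superset) auto
  then show ?thesis
    by (simp add: lookup_add power_add prod.distrib)
qed

lemma mpoly_expansion:
  "p = (\<Sum>\<mu> \<in> Poly_Mapping.keys p. Poly_Mapping.single \<mu> (Poly_Mapping.lookup p \<mu>))"
proof (rule poly_mapping_eqI)
  fix \<kappa>
  show "Poly_Mapping.lookup p \<kappa> = Poly_Mapping.lookup
      (\<Sum>\<mu> \<in> Poly_Mapping.keys p. Poly_Mapping.single \<mu> (Poly_Mapping.lookup p \<mu>)) \<kappa>"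
    by (simp add: lookup_sum lookup_single when_def in_keys_iff)
qed

context
  fixes c :: "'k::field \<Rightarrow> 'b::comm_ring_1"
  assumes c: "unital_hom c"
begin

interpretation c: unital_hom c by (rule c)

lemma mpoly_subst_superset:
  assumes "finite M" "Poly_Mapping.keys p \<subseteq> M"
  shows "mpoly_subst c s p = (\<Sum>\<mu>\<in>M. c (Poly_Mapping.lookup p \<mu>) * monomial_value s \<mu>)"
  unfolding mpoly_subst_def monomial_value_def[symmetric] using assms
  by (intro sum.mono_neutral_left) (auto simp: in_keys_iff c.hom_zero)

lemma mpoly_subst_single:
  "mpoly_subst c s (Poly_Mapping.single \<mu> a) = c a * monomial_value s \<mu>"
  by (subst mpoly_subst_superset[of "{\<mu>}"]) auto

lemma mpoly_subst_const: "mpoly_subst c s (mpoly_const a) = c a"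
  by (simp add: mpoly_const_def mpoly_subst_single monomial_value_def)

lemma mpoly_subst_var: "mpoly_subst c s (mpoly_var v) = s v"
  by (simp add: mpoly_var_def mpoly_subst_single monomial_value_def c.hom_one)

lemma mpoly_subst_add: "mpoly_subst c s (p + q) = mpoly_subst c s p + mpoly_subst c s q"
proof -
  let ?M = "Poly_Mapping.keys p \<union> Poly_Mapping.keys q"
  have "mpoly_subst c s r = (\<Sum>\<mu>\<in>?M. c (Poly_Mapping.lookup r \<mu>) * monomial_value s \<mu>)"
    if "r \<in> {p, q, p + q}" for r
    using that Poly_Mapping.keys_add[of p q] by (intro mpoly_subst_superset) auto
  then show ?thesis
    by (simp add: lookup_add c.hom_add algebra_simps sum.distrib)
qed

lemma mpoly_subst_sum: "mpoly_subst c s (sum f S) = (\<Sum>x\<in>S. mpoly_subst c s (f x))"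
  by (induction S rule: infinite_finite_induct)
    (simp_all add: mpoly_subst_add mpoly_subst_def[of c s 0])

lemma mpoly_subst_mult: "mpoly_subst c s (p * q) = mpoly_subst c s p * mpoly_subst c s q"
proof -
  have "p * q = (\<Sum>\<mu>\<in>Poly_Mapping.keys p. \<Sum>\<nu>\<in>Poly_Mapping.keys q.
      Poly_Mapping.single (\<mu> + \<nu>) (Poly_Mapping.lookup p \<mu> * Poly_Mapping.lookup q \<nu>))"
    by (subst mpoly_expansion[of p], subst mpoly_expansion[of q])
      (simp add: sum_product mult_single)
  then have "mpoly_subst c s (p * q) =
      (\<Sum>\<mu>\<in>Poly_Mapping.keys p. \<Sum>\<nu>\<in>Poly_Mapping.keys q.
        c (Poly_Mapping.lookup p \<mu> * Poly_Mapping.lookup q \<nu>) * monomial_value s (\<mu> + \<nu>))"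
    by (simp add: mpoly_subst_sum mpoly_subst_single)
  also have "\<dots> = mpoly_subst c s p * mpoly_subst c s q"
    unfolding mpoly_subst_def monomial_value_def[symmetric]
    by (simp add: sum_product c.hom_mult monomial_value_add mult_ac)
  finally show ?thesis .
qed

lemma unital_hom_mpoly_subst: "unital_hom (mpoly_subst c s)"
  using mpoly_subst_single[of s 0 1]
  by unfold_locales
    (simp_all add: mpoly_subst_add mpoly_subst_mult c.hom_one monomial_value_def)

end

text \<open>A homomorphism applied to the result of a substitution is again a substitution. All relations between evaluation, \<open>psi\<close>,
  homogenization and the specialization to a fiber are instances.\<close>

lemma hom_mpoly_subst:
  assumes "unital_hom h"
  shows "h (mpoly_subst c s p) = mpoly_subst (\<lambda>a. h (c a)) (\<lambda>v. h (s v)) p"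
proof -
  interpret unital_hom h by fact
  show ?thesis
    by (simp add: mpoly_subst_def hom_sum hom_mult hom_prod hom_power)
qed

lemma mpoly_subst_cong:
  assumes "p \<in> carrier (mpoly_ring V)" "\<And>v. v \<in> V \<Longrightarrow> s v = s' v"
  shows "mpoly_subst c s p = mpoly_subst c s' p"
  unfolding mpoly_subst_def
  using assms by (intro sum.cong prod.cong arg_cong2[of _ _ _ _ "(*)"] refl)
    (auto simp: mpoly_ring_def subset_iff)

lemma mpoly_subst_mpoly_const_var: "mpoly_subst mpoly_const mpoly_var p = p"
proof -
  have [simp]: "(mpoly_var v :: 'a mpoly) ^ n = Poly_Mapping.single (Poly_Mapping.single v n) 1" for v n
    by (induction n) (simp_all add: mpoly_var_def mult_single single_add[symmetric])
  have [simp]: "(\<Prod>v\<in>M. Poly_Mapping.single (f v) 1) = (Poly_Mapping.single (sum f M) 1 :: 'a mpoly)"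
    if "finite M" for M and f :: "var \<Rightarrow> var \<Rightarrow>\<^sub>0 nat"
    using that by (induction M) (simp_all add: mult_single)
  show ?thesis
    by (simp add: mpoly_subst_def mpoly_const_def mult_single mpoly_expansion[symmetric])
qed

abbreviation var_deg :: "(nat \<Rightarrow> nat) \<Rightarrow> var \<Rightarrow> nat" where
  "var_deg w \<equiv> case_var (\<lambda>_. 0) w"

text \<open>Substituting \<open>s v \<cdot> t^d\<close> for each variable \<open>v\<close> of degree \<open>d\<close> multiplies the value of a monomial by the
  power of \<open>t\<close> given by its weighted degree; the powers of \<open>t\<close> thus sort a polynomial by its homogeneous
  components. For \<open>s = \<pi>\<close> this is \<open>psi\<close>, for the identical substitution it is homogenization.\<close>

lemma coeff_graded_subst:
  fixes c :: "'k::field \<Rightarrow> 'b::comm_ring_1"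
  assumes "unital_hom c"
  shows "coeff (mpoly_subst (\<lambda>a. [:c a:]) (\<lambda>v. monom (s v) (var_deg w v)) f) d
    = mpoly_subst c s (hom_component w d f)"
proof -
  have power: "monom (s v) e ^ n = monom (s v ^ n) (n * e)" for v e n
    by (simp add: monom_power mult.commute)
  have prod: "(\<Prod>v\<in>M. monom (f v) (g v)) = monom (prod f M) (sum g M)"
    if "finite M" for M and f :: "var \<Rightarrow> 'b" and g :: "var \<Rightarrow> nat"
    using that by (induction M) (simp_all add: mult_monom)
  have "monomial_value (\<lambda>v. monom (s v) (var_deg w v)) \<mu> = monom (monomial_value s \<mu>) (wdeg w \<mu>)" for \<mu>
    by (simp add: monomial_value_def wdeg_def power prod)
  then have "mpoly_subst (\<lambda>a. [:c a:]) (\<lambda>v. monom (s v) (var_deg w v)) f =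
    (\<Sum>\<mu>\<in>Poly_Mapping.keys f. monom (c (Poly_Mapping.lookup f \<mu>) * monomial_value s \<mu>) (wdeg w \<mu>))"
    by (simp add: mpoly_subst_def monomial_value_def[symmetric] smult_monom)
  then show ?thesis
    by (simp add: hom_component_def mpoly_subst_sum[OF assms] mpoly_subst_single[OF assms]
        coeff_sum sum.If_cases Int_def)
qed

section \<open>Homogeneous components\<close>

lemma lookup_hom_component:
  "Poly_Mapping.lookup (hom_component w d f) \<mu> =
    (if wdeg w \<mu> = d then Poly_Mapping.lookup f \<mu> else 0)"
  by (auto simp: hom_component_def lookup_sum lookup_single when_def in_keys_iff)

lemma hom_component_add: "hom_component w d (f + g) = hom_component w d f + hom_component w d g"
  by (intro poly_mapping_eqI) (simp add: lookup_hom_component lookup_add)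

lemma hom_component_zero [simp]: "hom_component w d 0 = 0"
  by (simp add: hom_component_def)

lemma hom_component_hom_component:
  "hom_component w e (hom_component w d f) = (if e = d then hom_component w d f else 0)"
  by (intro poly_mapping_eqI) (simp add: lookup_hom_component)

lemma hom_component_in_carrier:
  assumes "f \<in> carrier (mpoly_ring V)"
  shows "hom_component w d f \<in> carrier (mpoly_ring V)"
  using assms by (auto simp: mpoly_ring_def in_keys_iff lookup_hom_component split: if_splits)

text \<open>The \<open>K\<close>-algebra homomorphism \<open>a\<^sub>i \<mapsto> a\<^sub>i\<close>, \<open>x\<^sub>j \<mapsto> x\<^sub>j t^(w j)\<close>. Its coefficients are the homogeneous
  components, so multiplicativity turns into the product formula for components.\<close>

definition homogenization :: "(nat \<Rightarrow> nat) \<Rightarrow> 'k::field mpoly \<Rightarrow> 'k mpoly poly" where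
  "homogenization w =
     mpoly_subst (\<lambda>a. [:mpoly_const a:]) (\<lambda>v. monom (mpoly_var v) (var_deg w v))"

lemma unital_hom_homogenization: "unital_hom (homogenization w)"
  unfolding homogenization_def
  by (rule unital_hom_mpoly_subst[OF unital_hom_comp[OF unital_hom_pconst unital_hom_mpoly_const]])

lemma coeff_homogenization: "coeff (homogenization w f) d = hom_component w d f"
  unfolding homogenization_def
  by (subst coeff_graded_subst[OF unital_hom_mpoly_const]) (rule mpoly_subst_mpoly_const_var)

lemma hom_component_one: "hom_component w d (1 :: 'k::field mpoly) = (if d = 0 then 1 else 0)"
  unfolding coeff_homogenization[symmetric] unital_hom.hom_one[OF unital_hom_homogenization]
  by simp

lemma hom_component_mult:
  fixes f g :: "'k::field mpoly"
  shows "hom_component w d (f * g) = (\<Sum>i\<le>d. hom_component w i f * hom_component w (d - i) g)"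
  unfolding coeff_homogenization[symmetric] unital_hom.hom_mult[OF unital_hom_homogenization]
  by (rule coeff_mult)

lemma sum_hom_components:
  "(\<Sum>d\<le>degree (homogenization w f). hom_component w d f) = f"
proof -
  have "poly (homogenization w f) 1 = f"
    unfolding homogenization_def hom_mpoly_subst[OF unital_hom_poly]
    by (simp add: poly_monom mpoly_subst_mpoly_const_var)
  then show ?thesis
    by (simp add: poly_altdef coeff_homogenization)
qed

section \<open>Prime ideals\<close>

text \<open>In a commutative ring with one, closure under addition and under multiplication by ring elements
  already gives closure under negation, since \<open>- a = a \<cdot> (- 1)\<close>.\<close>

lemma (in cring) primeidealI':
  assumes "P \<subseteq> carrier R" "\<zero> \<in> P" "\<one> \<notin> P"
    and add: "\<And>a b. a \<in> P \<Longrightarrow> b \<in> P \<Longrightarrow> a \<oplus> b \<in> P"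
    and mult: "\<And>a b. a \<in> P \<Longrightarrow> b \<in> carrier R \<Longrightarrow> a \<otimes> b \<in> P"
    and prime: "\<And>a b. a \<in> carrier R \<Longrightarrow> b \<in> carrier R \<Longrightarrow> a \<otimes> b \<in> P \<Longrightarrow> a \<in> P \<or> b \<in> P"
  shows "primeideal P R"
proof (rule primeidealI)
  show "ideal P R"
  proof (rule idealI)
    show "subgroup P (add_monoid R)"
    proof (rule add.subgroupI)
      fix a assume a: "a \<in> P"
      have "\<ominus> a = a \<otimes> (\<ominus> \<one>)"
        using a assms(1) by (simp add: r_minus subset_iff)
      then show "\<ominus> a \<in> P"
        using mult[OF a, of "\<ominus> \<one>"] by simp
    qed (use assms in auto)
  next
    fix a x assume ax: "a \<in> P" "x \<in> carrier R"
    show "a \<otimes> x \<in> P" using ax by (rule mult)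
    moreover have "x \<otimes> a = a \<otimes> x" using ax assms(1) by (simp add: m_comm subset_iff)
    ultimately show "x \<otimes> a \<in> P" by simp
  qed (rule ring_axioms)
qed (use is_cring assms(3) one_closed prime in auto)

lemma mpoly_ring_simps [simp]:
  "monoid.mult (mpoly_ring V) = (*)" "monoid.one (mpoly_ring V) = 1" "ring.zero (mpoly_ring V) = 0"
  "ring.add (mpoly_ring V) = (+)"
  by (simp_all add: mpoly_ring_def)

lemma mpoly_carrier_add:
  "f \<in> carrier (mpoly_ring V) \<Longrightarrow> g \<in> carrier (mpoly_ring V) \<Longrightarrow> f + g \<in> carrier (mpoly_ring V)"
  using cring.cring_simprules(1)[OF cring_mpoly_ring, of f V g] by simp

lemma mpoly_carrier_mult:
  "f \<in> carrier (mpoly_ring V) \<Longrightarrow> g \<in> carrier (mpoly_ring V) \<Longrightarrow> f * g \<in> carrier (mpoly_ring V)"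
  using cring.cring_simprules(5)[OF cring_mpoly_ring, of f V g] by simp

lemma mpoly_carrier_0: "0 \<in> carrier (mpoly_ring V)"
  by (simp add: mpoly_ring_def)

lemma mpoly_carrier_1: "1 \<in> carrier (mpoly_ring V)"
  by (simp add: mpoly_ring_def)

lemma mpoly_carrier_const: "mpoly_const a \<in> carrier (mpoly_ring V)"
  by (simp add: mpoly_ring_def mpoly_const_def)

lemma mpoly_carrier_var: "v \<in> V \<Longrightarrow> mpoly_var v \<in> carrier (mpoly_ring V)"
  by (simp add: mpoly_ring_def mpoly_var_def)

lemma mpoly_carrier_power:
  "f \<in> carrier (mpoly_ring V) \<Longrightarrow> f ^ n \<in> carrier (mpoly_ring V)"
  by (induction n) (simp_all add: mpoly_carrier_1 mpoly_carrier_mult)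

lemma mpoly_carrier_sum:
  "(\<And>x. x \<in> S \<Longrightarrow> f x \<in> carrier (mpoly_ring V)) \<Longrightarrow> sum f S \<in> carrier (mpoly_ring V)"
  by (induction S rule: infinite_finite_induct) (simp_all add: mpoly_carrier_0 mpoly_carrier_add)

lemma mpoly_carrier_prod:
  "(\<And>x. x \<in> S \<Longrightarrow> f x \<in> carrier (mpoly_ring V)) \<Longrightarrow> prod f S \<in> carrier (mpoly_ring V)"
  by (induction S rule: infinite_finite_induct) (simp_all add: mpoly_carrier_1 mpoly_carrier_mult)

lemmas mpoly_carrier_intros = mpoly_carrier_add mpoly_carrier_mult mpoly_carrier_0
  mpoly_carrier_1 mpoly_carrier_const mpoly_carrier_var mpoly_carrier_power
  mpoly_carrier_sum mpoly_carrier_prod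

lemma primeideal_kernel:
  fixes h :: "'k::field mpoly \<Rightarrow> 'b::idom"
  assumes "unital_hom h"
  shows "primeideal {f \<in> carrier (mpoly_ring V). h f = 0} (mpoly_ring V)"
proof -
  interpret unital_hom h by fact
  show ?thesis
    by (intro cring.primeidealI' cring_mpoly_ring)
      (auto simp: hom_add hom_mult hom_zero hom_one intro: mpoly_carrier_intros)
qed

lemma unital_hom_eval: "unital_hom (mpoly_subst id s :: 'k::field mpoly \<Rightarrow> 'k)"
  by (rule unital_hom_mpoly_subst[OF unital_hom_id])

lemma primeideal_rational_point: "primeideal (rational_point V c) (mpoly_ring V)"
  unfolding rational_point_def by (rule primeideal_kernel[OF unital_hom_eval])

text \<open>The operations of \<^const>\<open>mpoly_ring\<close> are those of the type; the locale restates the closure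
  properties of a prime ideal in terms of them.\<close>

locale mpoly_prime =
  fixes V :: "var set" and p :: "'k::field mpoly set"
  assumes prime: "primeideal p (mpoly_ring V)"
begin

interpretation primeideal p "mpoly_ring V" by (rule prime)

lemma carrier: "f \<in> p \<Longrightarrow> f \<in> carrier (mpoly_ring V)"
  by (rule a_Hcarr)

lemma zero: "0 \<in> p"
  using additive_subgroup.zero_closed[OF additive_subgroup_axioms] by simp

lemma one: "1 \<notin> p"
  using I_notcarr one_imp_carrier by auto

lemma add: "f \<in> p \<Longrightarrow> g \<in> p \<Longrightarrow> f + g \<in> p"
  using additive_subgroup.a_closed[OF additive_subgroup_axioms] by simp

lemma mult: "f \<in> p \<Longrightarrow> g \<in> carrier (mpoly_ring V) \<Longrightarrow> f * g \<in> p"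
  using I_r_closed by simp

lemma mult': "f \<in> p \<Longrightarrow> g \<in> carrier (mpoly_ring V) \<Longrightarrow> g * f \<in> p"
  using I_l_closed by simp

lemma diff: "f \<in> p \<Longrightarrow> g \<in> p \<Longrightarrow> f - g \<in> p"
  using add[of f "g * mpoly_const (- 1)"] mult[of g "mpoly_const (- 1)"] mpoly_carrier_const
  by (metis (no_types) diff_conv_add_uminus mpoly_const_def mult.right_neutral mult_minus_right
      single_one single_uminus)

lemma sum: "(\<And>x. x \<in> S \<Longrightarrow> f x \<in> p) \<Longrightarrow> sum f S \<in> p"
  by (induction S rule: infinite_finite_induct) (simp_all add: zero add)

lemma primeD:
  "f \<in> carrier (mpoly_ring V) \<Longrightarrow> g \<in> carrier (mpoly_ring V) \<Longrightarrow> f * g \<in> p \<Longrightarrow> f \<in> p \<or> g \<in> p"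
  using I_prime by simp

end

text \<open>The two primes through which a prime \<open>p\<close> is moved to the zero section. The homogeneous core is the
  largest homogeneous ideal inside \<open>p\<close>; its zero locus is the closure of the orbit of \<open>p\<close> under the
  scaling \<open>x\<^sub>j \<mapsto> t^(w j) x\<^sub>j\<close>. The second prime is the limit of this orbit for \<open>t\<close> tending to \<open>0\<close>: the
  polynomials whose restriction to the zero section vanishes at the image of \<open>p\<close>.\<close>

definition homogeneous_core :: "(nat \<Rightarrow> nat) \<Rightarrow> var set \<Rightarrow> 'k::field mpoly set \<Rightarrow> 'k mpoly set" where
  "homogeneous_core w V p = {f \<in> carrier (mpoly_ring V). \<forall>d. hom_component w d f \<in> p}"

definition zero_section_point :: "(nat \<Rightarrow> nat) \<Rightarrow> var set \<Rightarrow> 'k::field mpoly set \<Rightarrow> 'k mpoly set" where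
  "zero_section_point w V p = {f \<in> carrier (mpoly_ring V). hom_component w 0 f \<in> p}"

context mpoly_prime
begin

lemma homogeneous_core_subset: "homogeneous_core w V p \<subseteq> p"
proof
  fix f assume "f \<in> homogeneous_core w V p"
  then have "(\<Sum>d\<le>degree (homogenization w f). hom_component w d f) \<in> p"
    by (intro sum) (simp add: homogeneous_core_def)
  then show "f \<in> p" by (simp add: sum_hom_components)
qed

text \<open>The argument is that of Gauss' lemma. If neither \<open>f\<close> nor \<open>g\<close> lies in the core, take the lowest
  components \<open>f\<^sub>i\<close> and \<open>g\<^sub>j\<close> outside \<open>p\<close>. The component of \<open>f g\<close> in degree \<open>i + j\<close> is \<open>f\<^sub>i g\<^sub>j\<close> up to
  elements of \<open>p\<close>, so it is not in \<open>p\<close> either.\<close>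

lemma primeideal_homogeneous_core: "primeideal (homogeneous_core w V p) (mpoly_ring V)"
proof (intro cring.primeidealI' cring_mpoly_ring)
  fix f g :: "'k mpoly"
  assume fg: "f \<in> carrier (mpoly_ring V)" "g \<in> carrier (mpoly_ring V)"
    and "f \<otimes>\<^bsub>mpoly_ring V\<^esub> g \<in> homogeneous_core w V p"
  then have prod: "hom_component w d (f * g) \<in> p" for d
    by (simp add: homogeneous_core_def)
  note comp = hom_component_in_carrier[OF fg(1), of w] hom_component_in_carrier[OF fg(2), of w]
  show "f \<in> homogeneous_core w V p \<or> g \<in> homogeneous_core w V p"
  proof (rule ccontr)
    assume "\<not> ?thesis"
    then have "\<exists>i. hom_component w i f \<notin> p" "\<exists>j. hom_component w j g \<notin> p"
      using fg by (simp_all add: homogeneous_core_def)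
    then obtain i j where i: "hom_component w i f \<notin> p" "\<And>a. a < i \<Longrightarrow> hom_component w a f \<in> p"
      and j: "hom_component w j g \<notin> p" "\<And>a. a < j \<Longrightarrow> hom_component w a g \<in> p"
      unfolding exists_least_iff[of "\<lambda>i. hom_component w i _ \<notin> p"] by blast
    let ?t = "\<lambda>a. hom_component w a f * hom_component w (i + j - a) g"
    have rest: "(\<Sum>a \<in> {..i + j} - {i}. ?t a) \<in> p"
    proof (rule sum)
      fix a assume "a \<in> {..i + j} - {i}"
      then consider "a < i" | "i + j - a < j" by force
      then show "?t a \<in> p"
        by cases (auto intro: i j mult mult' comp)
    qed
    have "hom_component w (i + j) (f * g) = ?t i + (\<Sum>a \<in> {..i + j} - {i}. ?t a)"
      unfolding hom_component_mult by (subst sum.remove[of _ i]) auto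
    then have "?t i \<in> p"
      using diff[OF prod[of "i + j"] rest] by simp
    then show False
      using primeD[OF comp(1)[of i] comp(2)[of j]] i(1) j(1) by simp
  qed
next
  fix f g :: "'k mpoly"
  assume f: "f \<in> homogeneous_core w V p" and g: "g \<in> carrier (mpoly_ring V)"
  have "hom_component w d (f * g) \<in> p" for d
    unfolding hom_component_mult using f hom_component_in_carrier[OF g]
    by (intro sum mult) (simp_all add: homogeneous_core_def)
  then show "f \<otimes>\<^bsub>mpoly_ring V\<^esub> g \<in> homogeneous_core w V p"
    using f g by (simp add: homogeneous_core_def mpoly_carrier_mult)
next
  show "\<one>\<^bsub>mpoly_ring V\<^esub> \<notin> homogeneous_core w V p"
    using homogeneous_core_subset[of w] one by auto
qed (simp_all add: homogeneous_core_def hom_component_add zero mpoly_carrier_0 mpoly_carrier_add add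
    Collect_conj_eq)

lemma primeideal_zero_section_point: "primeideal (zero_section_point w V p) (mpoly_ring V)"
proof (intro cring.primeidealI' cring_mpoly_ring)
  fix f g :: "'k mpoly"
  assume fg: "f \<in> carrier (mpoly_ring V)" "g \<in> carrier (mpoly_ring V)"
    and "f \<otimes>\<^bsub>mpoly_ring V\<^esub> g \<in> zero_section_point w V p"
  then have "hom_component w 0 f * hom_component w 0 g \<in> p"
    by (simp add: zero_section_point_def hom_component_mult)
  then show "f \<in> zero_section_point w V p \<or> g \<in> zero_section_point w V p"
    using primeD[OF hom_component_in_carrier[OF fg(1)] hom_component_in_carrier[OF fg(2)]] fg
    by (simp add: zero_section_point_def)
qed (simp_all add: zero_section_point_def hom_component_add hom_component_mult hom_component_one zero one
    mpoly_carrier_intros add mult hom_component_in_carrier Collect_conj_eq)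

end

text \<open>A linear order on the variables induces a lexicographic, translation invariant linear order on the
  monomials. Comparing leading monomials, \<^typ>\<open>'k::field mpoly\<close> is then an integral domain.\<close>

instantiation var :: linorder
begin

definition var_code :: "var \<Rightarrow> nat" where
  "var_code = case_var (\<lambda>i. 2 * i) (\<lambda>j. Suc (2 * j))"

definition less_eq_var :: "var \<Rightarrow> var \<Rightarrow> bool" where
  "u \<le> v \<longleftrightarrow> var_code u \<le> var_code v"

definition less_var :: "var \<Rightarrow> var \<Rightarrow> bool" where
  "u < v \<longleftrightarrow> var_code u < var_code v"

lemma var_code_inj: "var_code u = var_code v \<Longrightarrow> u = v"
  by (cases u; cases v; simp add: var_code_def; presburger)

instance
  by standard (auto simp: less_eq_var_def less_var_def intro: var_code_inj)

end

lemma primeideal_zero: "primeideal {0 :: 'k::field mpoly} (mpoly_ring V)"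
proof -
  have "{f \<in> carrier (mpoly_ring V). id f = (0 :: 'k mpoly)} = {0}"
    by (auto simp: mpoly_carrier_0)
  moreover have "primeideal {f \<in> carrier (mpoly_ring V). id f = (0 :: 'k mpoly)} (mpoly_ring V)"
    by (rule primeideal_kernel[OF unital_hom_id])
  ultimately show ?thesis by simp
qed

section \<open>Zariski topology\<close>

lemma primeideal_subset_carrier: "primeideal p R \<Longrightarrow> p \<subseteq> carrier R"
  by (simp add: primeideal_def ideal_def additive_subgroup.a_subset)

lemma zero_locus_subset_Spec: "zero_locus R S \<subseteq> Spec R"
  by (auto simp: zero_locus_def)

lemma closedin_zariski: "closedin (zariski R) C \<longleftrightarrow> (\<exists>S \<subseteq> carrier R. C = zero_locus R S)"
proof
  assume "closedin (zariski R) C"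
  then obtain S where "C \<subseteq> Spec R" "S \<subseteq> carrier R" "Spec R - C = Spec R - zero_locus R S"
    by (auto simp: closedin_def openin_zariski topspace_zariski)
  then have "C = zero_locus R S"
    using zero_locus_subset_Spec[of R S] by blast
  then show "\<exists>S \<subseteq> carrier R. C = zero_locus R S" using \<open>S \<subseteq> carrier R\<close> by blast
next
  assume "\<exists>S \<subseteq> carrier R. C = zero_locus R S"
  then show "closedin (zariski R) C"
    using zero_locus_subset_Spec by (auto simp: closedin_def openin_zariski topspace_zariski)
qed

text \<open>Closed sets are stable under specialization, that is, under passing to larger primes.\<close>

lemma closedin_zariski_upward:
  assumes "closedin (zariski R) C" "p \<in> C" "p \<subseteq> q" "q \<in> Spec R"
  shows "q \<in> C"
  using assms by (auto simp: closedin_zariski zero_locus_def)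

text \<open>A subset that is both closed and open is stable under specialization and under generization. It
  therefore contains all points or none of a zigzag \<open>q \<supseteq> q\<^sub>1 \<subseteq> q\<^sub>2 \<supseteq> z\<close>, and a space in which
  every point is joined to one and the same \<open>z\<close> by such a zigzag is connected.\<close>

lemma connected_by_specializations:
  assumes X: "X \<subseteq> Spec R" "z \<in> X"
    and zigzag: "\<And>q. q \<in> X \<Longrightarrow> \<exists>q\<^sub>1\<in>X. \<exists>q\<^sub>2\<in>X. q\<^sub>1 \<subseteq> q \<and> q\<^sub>1 \<subseteq> q\<^sub>2 \<and> z \<subseteq> q\<^sub>2"
  shows "connected_nonempty (subtopology (zariski R) X)"
proof -
  let ?T = "subtopology (zariski R) X"
  have top: "topspace ?T = X" using X(1) by (auto simp: topspace_zariski)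
  have up: "q \<in> C" if "closedin ?T C" "p \<in> C" "p \<subseteq> q" "q \<in> X" for C p q
  proof -
    obtain D where "closedin (zariski R) D" "C = D \<inter> X"
      using \<open>closedin ?T C\<close> by (auto simp: closedin_subtopology)
    then show ?thesis using that X(1) closedin_zariski_upward[of R D p q] by blast
  qed
  have False
    if C: "closedin ?T C" "closedin ?T D" "X \<subseteq> C \<union> D" "C \<inter> D = {}" and "z \<in> C" "D \<noteq> {}" for C D
  proof -
    obtain q where q: "q \<in> D" "q \<in> X"
      using \<open>D \<noteq> {}\<close> closedin_subset[OF C(2)] top by blast
    then obtain q1 q2 where zz: "q1 \<in> X" "q2 \<in> X" "q1 \<subseteq> q" "q1 \<subseteq> q2" "z \<subseteq> q2"
      using zigzag by blast
    have "q2 \<in> C" using up[OF C(1) \<open>z \<in> C\<close> zz(5,2)] .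
    then have "q1 \<in> C" using up[OF C(2) _ zz(4,2)] C(3,4) zz(1) by blast
    then show False using up[OF C(1) _ zz(3) q(2)] q C(4) by blast
  qed
  then have "connected_space ?T"
    unfolding connected_space_closedin top using X(2) by (metis Int_commute Un_commute Un_iff subsetD)
  then show ?thesis using X(2) top by (auto simp: connected_nonempty_def)
qed

text \<open>The prime \<open>p\<close> is itself a point of its zero locus and specializes to every other point of it, so a
  closed set containing \<open>p\<close> contains the whole locus.\<close>

lemma irreducible_zero_locus:
  assumes "primeideal p R"
  shows "closedin (zariski R) (zero_locus R p)" "irreducible_in (zariski R) (zero_locus R p)"
proof -
  show cl: "closedin (zariski R) (zero_locus R p)"
    using primeideal_subset_carrier[OF assms] by (auto simp: closedin_zariski)
  have p: "p \<in> zero_locus R p" using assms by (simp add: zero_locus_def Spec_def)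
  have "zero_locus R p \<subseteq> C" if "closedin (zariski R) C" "p \<in> C" for C
    using closedin_zariski_upward[OF that] by (auto simp: zero_locus_def)
  then show "irreducible_in (zariski R) (zero_locus R p)"
    unfolding irreducible_in_def using p closedin_subset[OF cl] by blast
qed

lemma irreducible_in_subtopology:
  assumes "Z \<subseteq> Y"
  shows "irreducible_in (subtopology T Y) Z \<longleftrightarrow> irreducible_in T Z"
proof -
  have "(Z \<subseteq> (C \<inter> Y) \<union> (D \<inter> Y) \<longrightarrow> Z \<subseteq> C \<inter> Y \<or> Z \<subseteq> D \<inter> Y) \<longleftrightarrow>
        (Z \<subseteq> C \<union> D \<longrightarrow> Z \<subseteq> C \<or> Z \<subseteq> D)" for C D
    using assms by blast
  then show ?thesis
    unfolding irreducible_in_def closedin_subtopology using assms by (smt (verit) Int_subset_iff topspace_subtopology)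
qed

text \<open>Every irreducible closed set has a generic point, the intersection of its primes: if a
  product \<open>a b\<close> vanishes on the set, the set is covered by the zero loci of \<open>a\<close> and \<open>b\<close>.\<close>

lemma irreducible_closed_is_zero_locus:
  fixes R (structure)
  assumes "cring R" "closedin (zariski R) Z" "irreducible_in (zariski R) Z"
  shows "primeideal (\<Inter>Z) R" "Z = zero_locus R (\<Inter>Z)"
proof -
  interpret cring R by fact
  obtain S where S: "S \<subseteq> carrier R" "Z = zero_locus R S"
    using assms(2) by (auto simp: closedin_zariski)
  have ne: "Z \<noteq> {}" using assms(3) by (simp add: irreducible_in_def)
  have Z: "primeideal q R" if "q \<in> Z" for q
    using that S by (simp add: zero_locus_def Spec_def)
  have idl: "ideal q R" if "q \<in> Z" for q
    using Z[OF that] by (simp add: primeideal_def)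
  show "primeideal (\<Inter>Z) R"
  proof (rule primeidealI')
    show "\<Inter>Z \<subseteq> carrier R" using ne Z primeideal_subset_carrier by blast
    show "\<zero> \<in> \<Inter>Z" using idl by (auto simp: ideal_def additive_subgroup.zero_closed)
    show "\<one> \<notin> \<Inter>Z"
    proof
      assume "\<one> \<in> \<Inter>Z"
      then obtain q where "q \<in> Z" "\<one> \<in> q" using ne by blast
      then show False
        using Z[of q] ideal.one_imp_carrier[OF idl[of q]] by (auto simp: primeideal_def primeideal_axioms_def)
    qed
  next
    fix a b assume "a \<in> \<Inter>Z" "b \<in> \<Inter>Z"
    then show "a \<oplus> b \<in> \<Inter>Z" using idl by (auto simp: ideal_def intro: additive_subgroup.a_closed)
  next
    fix a b assume "a \<in> \<Inter>Z" "b \<in> carrier R"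
    then show "a \<otimes> b \<in> \<Inter>Z" using idl by (auto intro: ideal.I_r_closed)
  next
    fix a b assume ab: "a \<in> carrier R" "b \<in> carrier R" "a \<otimes> b \<in> \<Inter>Z"
    have "Z \<subseteq> zero_locus R {a} \<union> zero_locus R {b}"
      using ab Z by (auto simp: zero_locus_def Spec_def dest: primeideal.I_prime)
    moreover have "closedin (zariski R) (zero_locus R {a})" "closedin (zariski R) (zero_locus R {b})"
      using ab by (auto simp: closedin_zariski)
    ultimately have "Z \<subseteq> zero_locus R {a} \<or> Z \<subseteq> zero_locus R {b}"
      using assms(3) by (simp add: irreducible_in_def)
    then show "a \<in> \<Inter>Z \<or> b \<in> \<Inter>Z" by (auto simp: zero_locus_def)
  qed
  show "Z = zero_locus R (\<Inter>Z)"
    using S by (auto simp: zero_locus_def)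
qed

text \<open>Irreducible closed subsets of the zero locus of \<open>p\<close> correspond to primes above \<open>p\<close>, with inclusions
  reversed. The prime \<open>m\<close> provides a chain of length one, and a chain
  of length two would contain two primes strictly above \<open>p\<close>.\<close>

lemma krull_dim_zero_locus_eq_1:
  assumes R: "cring R" and p: "primeideal p R" and m: "primeideal m R" "p \<subset> m"
    and max: "\<And>q\<^sub>1 q\<^sub>2. primeideal q\<^sub>1 R \<Longrightarrow> primeideal q\<^sub>2 R \<Longrightarrow> p \<subset> q\<^sub>1 \<Longrightarrow> q\<^sub>1 \<subset> q\<^sub>2 \<Longrightarrow> False"
  shows "krull_dim (subtopology (zariski R) (zero_locus R p)) = 1"
proof -
  let ?T = "subtopology (zariski R) (zero_locus R p)"
  let ?L = "{enat n | n. \<exists>Z :: nat \<Rightarrow> 'a set set.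
     (\<forall>i\<le>n. closedin ?T (Z i) \<and> irreducible_in ?T (Z i)) \<and> (\<forall>i<n. Z i \<subset> Z (Suc i))}"
  have cl: "closedin ?T Z \<longleftrightarrow> closedin (zariski R) Z \<and> Z \<subseteq> zero_locus R p" for Z
    using irreducible_zero_locus(1)[OF p] by (rule closedin_closed_subtopology)
  have closed_irred: "closedin ?T (zero_locus R q) \<and> irreducible_in ?T (zero_locus R q)"
    if "primeideal q R" "p \<subseteq> q" for q
  proof -
    have "zero_locus R q \<subseteq> zero_locus R p" using that by (auto simp: zero_locus_def)
    then show ?thesis
      using irreducible_zero_locus[OF that(1)] by (simp add: cl irreducible_in_subtopology)
  qed
  have "p \<in> zero_locus R p" "p \<notin> zero_locus R m"
    using p m by (auto simp: zero_locus_def Spec_def)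
  then have "zero_locus R m \<subset> zero_locus R p"
    using m by (auto simp: zero_locus_def)
  then have "enat 1 \<in> ?L"
    using closed_irred[OF p] closed_irred[OF m(1)] m(2)
    by (auto intro!: exI[of _ "\<lambda>i :: nat. if i = 0 then zero_locus R m else zero_locus R p"])
  moreover have "n \<le> 1"
    if chain: "\<forall>i\<le>n. closedin ?T (Z i) \<and> irreducible_in ?T (Z i)" "\<forall>i<n. Z i \<subset> Z (Suc i)" for n Z
  proof (rule ccontr)
    assume "\<not> n \<le> 1"
    then have n: "0 \<le> n" "1 \<le> n" "2 \<le> n" by auto
    have Z: "primeideal (\<Inter>(Z i)) R" "Z i = zero_locus R (\<Inter>(Z i))" "p \<subseteq> \<Inter>(Z i)" if "i \<le> n" for i
    proof -
      have *: "closedin (zariski R) (Z i)" "Z i \<subseteq> zero_locus R p" "irreducible_in ?T (Z i)"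
        using chain(1) that by (auto simp: cl)
      then have "irreducible_in (zariski R) (Z i)" by (simp add: irreducible_in_subtopology)
      then show "primeideal (\<Inter>(Z i)) R" "Z i = zero_locus R (\<Inter>(Z i))"
        using irreducible_closed_is_zero_locus[OF R *(1)] by auto
      show "p \<subseteq> \<Inter>(Z i)" using *(2) by (auto simp: zero_locus_def)
    qed
    have "Z 0 \<subset> Z 1" "Z 1 \<subset> Z 2"
      using chain(2) n by (auto simp: numeral_2_eq_2)
    then have "\<Inter>(Z 2) \<subset> \<Inter>(Z 1)" "\<Inter>(Z 1) \<subset> \<Inter>(Z 0)"
      using Z(2)[OF n(1)] Z(2)[OF n(2)] Z(2)[OF n(3)] Inter_anti_mono
      by (metis order_less_le)+
    then show False
      using max[OF Z(1)[OF n(2)] Z(1)[OF n(1)]] Z(3)[OF n(3)] by blast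
  qed
  ultimately have "Sup ?L = enat 1"
    by (intro antisym Sup_least Sup_upper) auto
  then show ?thesis by (simp add: krull_dim_def one_enat_def)
qed

section \<open>Primes of a quotient ring\<close>

context ring
begin

text \<open>A prime \<open>q\<close> of a quotient ring is a set of cosets, so its preimage in the ring is the union of \<open>q\<close>.\<close>

lemma primeideal_Union_quot:
  assumes "cring R" "ideal I R" "primeideal q (R Quot I)"
  shows "primeideal (\<Union>q) R" "I \<subseteq> \<Union>q" "(+>) I ` (\<Union>q) = q"
    and "\<And>a. a \<in> carrier R \<Longrightarrow> a \<in> \<Union>q \<longleftrightarrow> I +> a \<in> q"
proof -
  interpret cring R by fact
  have q: "ideal q (R Quot I)" using assms(3) by (simp add: primeideal_def)
  have sub: "q \<subseteq> carrier (R Quot I)" by (rule primeideal_subset_carrier[OF assms(3)])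
  show mem: "\<And>a. a \<in> carrier R \<Longrightarrow> a \<in> \<Union>q \<longleftrightarrow> I +> a \<in> q"
    by (rule canonical_proj_vimage_mem_iff[OF assms(2) sub])
  have q': "ideal (\<Union>q) R" by (rule quot_ideal_imp_ring_ideal[OF assms(2) q])
  have "q \<in> (\<lambda>J. (+>) I ` J) ` {J. ideal J R \<and> I \<subseteq> J}"
    unfolding bij_betw_imp_surj_on[OF quot_ideal_correspondence[OF assms(2)]] using q by simp
  then obtain J where J: "ideal J R" "I \<subseteq> J" "q = (+>) I ` J"
    by (elim imageE CollectE conjE)
  then have "\<Union>q = J" using ideal_incl_iff[OF assms(2) J(1)] by simp
  then show "I \<subseteq> \<Union>q" "(+>) I ` (\<Union>q) = q" using J by auto
  have hom: "(+>) I \<in> ring_hom R (R Quot I)" by (rule ideal.rcos_ring_hom[OF assms(2)])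
  show "primeideal (\<Union>q) R"
  proof (rule primeidealI[OF q' assms(1)])
    show "carrier R \<noteq> \<Union>q"
    proof
      assume "carrier R = \<Union>q"
      then have "\<one> \<in> \<Union>q" using one_closed by (rule subst)
      then have "\<one>\<^bsub>R Quot I\<^esub> \<in> q"
        using mem[OF one_closed] ring_hom_one[OF hom] by metis
      then show False
        using ideal.one_imp_carrier[OF q] primeideal.I_notcarr[OF assms(3)] by simp
    qed
  next
    fix a b assume ab: "a \<in> carrier R" "b \<in> carrier R" "a \<otimes> b \<in> \<Union>q"
    then have "(I +> a) \<otimes>\<^bsub>R Quot I\<^esub> (I +> b) \<in> q"
      using mem[of "a \<otimes> b"] ring_hom_mult[OF hom] by simp
    then show "a \<in> \<Union>q \<or> b \<in> \<Union>q"
      using primeideal.I_prime[OF assms(3)] ring_hom_closed[OF hom] ab mem by metis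
  qed
qed

lemma primeideal_image_quot:
  assumes "cring R" "ideal I R" "primeideal p R" "I \<subseteq> p"
  shows "primeideal ((+>) I ` p) (R Quot I)"
    and "\<And>a. a \<in> carrier R \<Longrightarrow> I +> a \<in> (+>) I ` p \<longleftrightarrow> a \<in> p"
proof -
  interpret cring R by fact
  have p: "ideal p R" using assms(3) by (simp add: primeideal_def)
  have img: "ideal ((+>) I ` p) (R Quot I)" by (rule ring_ideal_imp_quot_ideal[OF assms(2) p])
  have "\<Union>((+>) I ` p) = p" using ideal_incl_iff[OF assms(2) p] assms(4) by simp
  then show mem: "\<And>a. a \<in> carrier R \<Longrightarrow> I +> a \<in> (+>) I ` p \<longleftrightarrow> a \<in> p"
    using canonical_proj_vimage_mem_iff[OF assms(2) additive_subgroup.a_subset[OF ideal.axioms(1)[OF img]]]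
    by simp
  have hom: "(+>) I \<in> ring_hom R (R Quot I)" by (rule ideal.rcos_ring_hom[OF assms(2)])
  have rep: "\<exists>a\<in>carrier R. x = I +> a" if "x \<in> carrier (R Quot I)" for x
    using that by (auto simp: FactRing_def A_RCOSETS_def')
  show "primeideal ((+>) I ` p) (R Quot I)"
  proof (rule primeidealI[OF img ideal.quotient_is_cring[OF assms(2,1)]])
    show "carrier (R Quot I) \<noteq> (+>) I ` p"
    proof
      assume "carrier (R Quot I) = (+>) I ` p"
      then have "\<one> \<in> p" using mem[of \<one>] ring_hom_closed[OF hom, of \<one>] by simp
      then show False
        using ideal.one_imp_carrier[OF p] primeideal.I_notcarr[OF assms(3)] by simp
    qed
  next
    fix x y
    assume xy: "x \<in> carrier (R Quot I)" "y \<in> carrier (R Quot I)"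
      and prod: "x \<otimes>\<^bsub>R Quot I\<^esub> y \<in> (+>) I ` p"
    then obtain a b where ab: "a \<in> carrier R" "b \<in> carrier R" "x = I +> a" "y = I +> b"
      using rep by metis
    then have "a \<otimes> b \<in> p"
      using prod mem[of "a \<otimes> b"] ring_hom_mult[OF hom ab(1,2)] by simp
    then show "x \<in> (+>) I ` p \<or> y \<in> (+>) I ` p"
      using primeideal.I_prime[OF assms(3) ab(1,2)] ab by auto
  qed
qed

end

text \<open>The correspondence of primes preserves inclusions, so zigzags can be constructed upstairs, where
  primes consist of polynomials.\<close>

lemma connected_in_Spec_quot:
  assumes "cring R" "ideal I R"
    and X: "\<And>p. p \<in> X \<Longrightarrow> primeideal p R \<and> I \<subseteq> p" and z: "z \<in> X"
    and zigzag: "\<And>p. p \<in> X \<Longrightarrow> \<exists>p\<^sub>1\<in>X. \<exists>p\<^sub>2\<in>X. p\<^sub>1 \<subseteq> p \<and> p\<^sub>1 \<subseteq> p\<^sub>2 \<and> z \<subseteq> p\<^sub>2"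
  shows "connected_nonempty (subtopology (zariski (R Quot I)) ((`) ((+>\<^bsub>R\<^esub>) I) ` X))"
proof (rule connected_by_specializations)
  interpret cring R by fact
  show "(`) ((+>\<^bsub>R\<^esub>) I) ` X \<subseteq> Spec (R Quot I)"
    using X primeideal_image_quot(1)[OF assms(1,2)] by (auto simp: Spec_def)
  show "(+>\<^bsub>R\<^esub>) I ` z \<in> (`) ((+>\<^bsub>R\<^esub>) I) ` X" using z by blast
  fix q assume "q \<in> (`) ((+>\<^bsub>R\<^esub>) I) ` X"
  then obtain p where p: "p \<in> X" "q = (+>\<^bsub>R\<^esub>) I ` p" by blast
  obtain p1 p2 where "p1 \<in> X" "p2 \<in> X" "p1 \<subseteq> p" "p1 \<subseteq> p2" "z \<subseteq> p2"
    using zigzag[OF p(1)] by blast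
  then show "\<exists>q\<^sub>1\<in>(`) ((+>\<^bsub>R\<^esub>) I) ` X. \<exists>q\<^sub>2\<in>(`) ((+>\<^bsub>R\<^esub>) I) ` X.
      q\<^sub>1 \<subseteq> q \<and> q\<^sub>1 \<subseteq> q\<^sub>2 \<and> (+>\<^bsub>R\<^esub>) I ` z \<subseteq> q\<^sub>2"
    unfolding p(2) by (meson image_eqI image_mono)
qed

text \<open>The property \<open>Q\<close> of the preimage prime is left open: it is void for the whole spectrum, and
  prescribes the contraction to \<open>A\<close> for a fiber.\<close>

lemma Spec_quot_restricted:
  assumes "cring R" "ideal I R"
  shows "{q \<in> Spec (R Quot I). Q {a \<in> carrier R. I +>\<^bsub>R\<^esub> a \<in> q}} =
    (`) ((+>\<^bsub>R\<^esub>) I) ` {p. primeideal p R \<and> I \<subseteq> p \<and> Q p}"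
proof (intro equalityI subsetI)
  interpret cring R by fact
  fix q assume q: "q \<in> {q \<in> Spec (R Quot I). Q {a \<in> carrier R. I +>\<^bsub>R\<^esub> a \<in> q}}"
  then have "primeideal q (R Quot I)" by (simp add: Spec_def)
  note U = primeideal_Union_quot[OF assms this]
  have "{a \<in> carrier R. I +>\<^bsub>R\<^esub> a \<in> q} = \<Union>q"
    using U(4) primeideal_subset_carrier[OF U(1)] by blast
  then show "q \<in> (`) ((+>\<^bsub>R\<^esub>) I) ` {p. primeideal p R \<and> I \<subseteq> p \<and> Q p}"
    using q U(1,2) U(3)[symmetric] by (simp add: rev_image_eqI)
next
  interpret cring R by fact
  fix q assume "q \<in> (`) ((+>\<^bsub>R\<^esub>) I) ` {p. primeideal p R \<and> I \<subseteq> p \<and> Q p}"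
  then obtain p where p: "primeideal p R" "I \<subseteq> p" "Q p" and q: "q = (+>\<^bsub>R\<^esub>) I ` p" by blast
  note im = primeideal_image_quot[OF assms p(1,2)]
  have "{a \<in> carrier R. I +>\<^bsub>R\<^esub> a \<in> q} = p"
    using im(2) primeideal_subset_carrier[OF p(1)] unfolding q by blast
  then show "q \<in> {q \<in> Spec (R Quot I). Q {a \<in> carrier R. I +>\<^bsub>R\<^esub> a \<in> q}}"
    using im(1) p(3) by (simp add: Spec_def q)
qed

section \<open>Connectedness of the fibers and of the total space\<close>

lemma homogeneous_core_greatest:
  assumes "J \<subseteq> carrier (mpoly_ring V)" "J \<subseteq> p" "\<And>f d. f \<in> J \<Longrightarrow> hom_component w d f \<in> J"
  shows "J \<subseteq> homogeneous_core w V p"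
  using assms by (auto simp: homogeneous_core_def)

lemma homogeneous_core_subset_zero_section_point: "homogeneous_core w V p \<subseteq> zero_section_point w V p"
  by (auto simp: homogeneous_core_def zero_section_point_def)

lemma zero_section_point_mono: "p \<subseteq> q \<Longrightarrow> zero_section_point w V p \<subseteq> zero_section_point w V q"
  by (auto simp: zero_section_point_def)

text \<open>If the elements of a homogeneous set of polynomials have no component of degree \<open>0\<close>, then the set
  vanishes on the whole zero section. The latter is irreducible, with the polynomials without
  component of degree \<open>0\<close> as its generic point \<open>z\<close>, and every prime \<open>p\<close> is joined to it via the core of
  \<open>p\<close> and the limit of \<open>p\<close> on the zero section.\<close>

lemma connected_cone:
  fixes J :: "'k::field mpoly set"
  assumes "J \<subseteq> carrier (mpoly_ring V)" "\<And>f d. f \<in> J \<Longrightarrow> hom_component w d f \<in> J"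
    and "\<And>f. f \<in> J \<Longrightarrow> hom_component w 0 f = 0"
  shows "connected_nonempty (subtopology (zariski (mpoly_ring V)) (zero_locus (mpoly_ring V) J))"
proof (rule connected_by_specializations[OF zero_locus_subset_Spec])
  have in_locus: "p \<in> zero_locus (mpoly_ring V) J \<longleftrightarrow> primeideal p (mpoly_ring V) \<and> J \<subseteq> p" for p
    by (simp add: zero_locus_def Spec_def)
  have J: "J \<subseteq> zero_section_point w V {0}"
    using assms by (auto simp: zero_section_point_def)
  show "zero_section_point w V {0} \<in> zero_locus (mpoly_ring V) J"
    using J mpoly_prime.primeideal_zero_section_point[OF mpoly_prime.intro[OF primeideal_zero]]
    by (simp add: in_locus)
  fix p assume "p \<in> zero_locus (mpoly_ring V) J"
  then have p: "primeideal p (mpoly_ring V)" "J \<subseteq> p" by (auto simp: in_locus)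
  interpret mpoly_prime V p by (rule mpoly_prime.intro[OF p(1)])
  have z: "zero_section_point w V {0} \<subseteq> zero_section_point w V p"
    using zero by (intro zero_section_point_mono) simp
  have "homogeneous_core w V p \<in> zero_locus (mpoly_ring V) J"
    using primeideal_homogeneous_core homogeneous_core_greatest[OF assms(1) p(2) assms(2)]
    by (simp add: in_locus)
  moreover have "zero_section_point w V p \<in> zero_locus (mpoly_ring V) J"
    using primeideal_zero_section_point J z by (auto simp: in_locus)
  ultimately show "\<exists>p\<^sub>1\<in>zero_locus (mpoly_ring V) J. \<exists>p\<^sub>2\<in>zero_locus (mpoly_ring V) J.
      p\<^sub>1 \<subseteq> p \<and> p\<^sub>1 \<subseteq> p\<^sub>2 \<and> zero_section_point w V {0} \<subseteq> p\<^sub>2"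
    using homogeneous_core_subset[of w] homogeneous_core_subset_zero_section_point[of w V p] z
    by (intro bexI[of _ "homogeneous_core w V p"] bexI[of _ "zero_section_point w V p"]) simp_all
qed

text \<open>As the weights of the \<open>x\<^sub>j\<close> are positive, only monomials in the \<open>a\<^sub>i\<close> have degree \<open>0\<close>.\<close>

lemma hom_component_zero_in_ring_A:
  assumes "\<forall>j\<in>{1..k}. 0 < w j" "f \<in> carrier (ring_P m k)"
  shows "hom_component w 0 f \<in> carrier (ring_A m)"
proof -
  have "Poly_Mapping.keys \<mu> \<subseteq> avars m"
    if \<mu>: "\<mu> \<in> Poly_Mapping.keys f" "wdeg w \<mu> = 0" for \<mu>
  proof
    fix v assume v: "v \<in> Poly_Mapping.keys \<mu>"
    then have "v \<in> avars m \<union> xvars k" using assms(2) \<mu>(1) by (auto simp: mpoly_ring_def)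
    moreover have "var_deg w v = 0" using \<mu>(2) v by (auto simp: wdeg_def in_keys_iff)
    ultimately show "v \<in> avars m" using assms(1) by (auto simp: xvars_def)
  qed
  moreover have "\<mu> \<in> Poly_Mapping.keys f" "wdeg w \<mu> = 0"
    if "\<mu> \<in> Poly_Mapping.keys (hom_component w 0 f)" for \<mu>
    using that by (auto simp: in_keys_iff lookup_hom_component split: if_splits)
  ultimately show ?thesis by (simp add: mpoly_ring_def)
qed

lemma hom_component_ring_A:
  assumes "f \<in> carrier (ring_A m)"
  shows "hom_component w d f = (if d = 0 then f else 0)"
proof -
  have deg: "wdeg w \<mu> = 0" if "\<mu> \<in> Poly_Mapping.keys f" for \<mu>
  proof -
    have "Poly_Mapping.keys \<mu> \<subseteq> avars m" using that assms by (simp add: mpoly_ring_def)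
    then have "var_deg w v = 0" if "v \<in> Poly_Mapping.keys \<mu>" for v
      using that by (auto simp: avars_def)
    then show ?thesis by (simp add: wdeg_def)
  qed
  have lookup: "Poly_Mapping.lookup f \<mu> = 0" if "wdeg w \<mu> \<noteq> 0" for \<mu>
    using deg[of \<mu>] that by (auto simp: in_keys_iff)
  show ?thesis
  proof (rule poly_mapping_eqI)
    fix \<mu>
    show "Poly_Mapping.lookup (hom_component w d f) \<mu> = Poly_Mapping.lookup (if d = 0 then f else 0) \<mu>"
      using lookup[of \<mu>] by (cases "wdeg w \<mu> = 0") (auto simp: lookup_hom_component)
  qed
qed

lemma ring_A_subset_ring_P: "carrier (ring_A m) \<subseteq> carrier (ring_P m k)"
  unfolding mpoly_ring_def by fastforce

context
  fixes m k :: nat and w :: "nat \<Rightarrow> nat" and I :: "'k::field mpoly set"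
  assumes pos: "positive_algebra m k w I"
begin

lemma positive_algebraD:
  shows "\<forall>j\<in>{1..k}. 0 < w j" and "ideal I (ring_P m k)" and "I \<subseteq> carrier (ring_P m k)"
    and "\<And>f d. f \<in> I \<Longrightarrow> hom_component w d f \<in> I" and "I \<inter> carrier (ring_A m) = {0}"
proof -
  note d = pos[unfolded positive_algebra_def homogeneous_ideal_def]
  show "\<forall>j\<in>{1..k}. 0 < w j" using d by (rule conjunct1)
  show I: "ideal I (ring_P m k)" using d by (elim conjE)
  show "I \<subseteq> carrier (ring_P m k)"
    by (rule additive_subgroup.a_subset[OF ideal.axioms(1)[OF I]])
  show "hom_component w d f \<in> I" if "f \<in> I" for f d using d that by simp
  show "I \<inter> carrier (ring_A m) = {0}" using d by (elim conjE)
qed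

text \<open>Homogeneity puts the component of degree \<open>0\<close> into \<open>I \<inter> A = 0\<close>. In other words, \<open>I\<close> lies in the
  ideal generated by the \<open>x\<^sub>j\<close>.\<close>

lemma hom_component_zero_eq_0:
  assumes "f \<in> I"
  shows "hom_component w 0 f = 0"
proof -
  have "f \<in> carrier (ring_P m k)" using assms positive_algebraD(3) by blast
  then have "hom_component w 0 f \<in> I \<inter> carrier (ring_A m)"
    using positive_algebraD(4)[OF assms] hom_component_zero_in_ring_A[OF positive_algebraD(1)] by simp
  then show ?thesis using positive_algebraD(5) by simp
qed

text \<open>Moving a prime to its core or to the zero section keeps it inside \<open>Spec R\<close> and inside its fiber over
  \<open>Spec A\<close>, because elements of \<open>A\<close> are homogeneous of degree \<open>0\<close>.\<close>

lemma contraction_of_prime: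
  assumes p: "primeideal p (ring_P m k)"
  defines "V \<equiv> avars m \<union> xvars k"
  shows "primeideal (zero_section_point w V p) (ring_P m k)" "I \<subseteq> zero_section_point w V p"
    "zero_section_point w V p \<inter> carrier (ring_A m) = p \<inter> carrier (ring_A m)"
    "primeideal (homogeneous_core w V p) (ring_P m k)"
    "I \<subseteq> p \<Longrightarrow> I \<subseteq> homogeneous_core w V p"
    "homogeneous_core w V p \<inter> carrier (ring_A m) = p \<inter> carrier (ring_A m)"
    "homogeneous_core w V p \<subseteq> p"
proof -
  interpret mpoly_prime V p using p unfolding V_def by (rule mpoly_prime.intro)
  show "primeideal (zero_section_point w V p) (ring_P m k)"
    "primeideal (homogeneous_core w V p) (ring_P m k)"
    using primeideal_zero_section_point primeideal_homogeneous_core by (simp_all add: V_def)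
  show "I \<subseteq> zero_section_point w V p"
    using hom_component_zero_eq_0 positive_algebraD(3) zero by (auto simp: zero_section_point_def V_def)
  show "I \<subseteq> homogeneous_core w V p" if "I \<subseteq> p"
    using that positive_algebraD(3,4) by (intro homogeneous_core_greatest) (auto simp: V_def)
  have A: "f \<in> carrier (mpoly_ring V)" if "f \<in> carrier (ring_A m)" for f :: "'k mpoly"
    using that ring_A_subset_ring_P by (auto simp: V_def)
  show "zero_section_point w V p \<inter> carrier (ring_A m) = p \<inter> carrier (ring_A m)"
    by (auto simp: zero_section_point_def hom_component_ring_A A)
  show "homogeneous_core w V p \<inter> carrier (ring_A m) = p \<inter> carrier (ring_A m)"
  proof -
    have "(\<forall>d::nat. (if d = 0 then f else 0) \<in> p) \<longleftrightarrow> f \<in> p" for f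
      using zero by metis
    then show ?thesis by (auto simp: homogeneous_core_def hom_component_ring_A A zero)
  qed
  show "homogeneous_core w V p \<subseteq> p" by (rule homogeneous_core_subset)
qed

text \<open>The zigzag ends in the generic point of the zero section, which is a copy of the irreducible
  space \<open>Spec A\<close>.\<close>

lemma connected_Spec_ring_R: "connected_nonempty (zariski (ring_R m k I))"
proof -
  let ?V = "avars m \<union> xvars k"
  let ?P = "ring_P m k :: 'k mpoly ring"
  let ?X = "{p. primeideal p ?P \<and> I \<subseteq> p}"
  let ?z = "zero_section_point w ?V {0}"
  note P = cring_mpoly_ring[of ?V]
  note I = positive_algebraD(2)
  have "Spec (?P Quot I) = (`) ((+>\<^bsub>?P\<^esub>) I) ` ?X"
    using Spec_quot_restricted[OF P I, of "\<lambda>_. True"] by simp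
  moreover have "connected_nonempty (subtopology (zariski (?P Quot I)) ((`) ((+>\<^bsub>?P\<^esub>) I) ` ?X))"
  proof (rule connected_in_Spec_quot[OF P I])
    show "?z \<in> ?X" using contraction_of_prime(1,2)[OF primeideal_zero] by simp
    fix p assume p: "p \<in> ?X"
    then have zero: "{0} \<subseteq> p" using mpoly_prime.zero[OF mpoly_prime.intro[of p ?V]] by simp
    show "\<exists>p\<^sub>1\<in>?X. \<exists>p\<^sub>2\<in>?X. p\<^sub>1 \<subseteq> p \<and> p\<^sub>1 \<subseteq> p\<^sub>2 \<and> ?z \<subseteq> p\<^sub>2"
      using p contraction_of_prime[of p] homogeneous_core_subset_zero_section_point[of w ?V p]
        zero_section_point_mono[OF zero, of w ?V]
      by (intro bexI[of _ "homogeneous_core w ?V p"] bexI[of _ "zero_section_point w ?V p"]) simp_all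
  qed simp
  ultimately show ?thesis
    by (metis ring_R_def subtopology_topspace topspace_zariski)
qed

text \<open>Over a rational base point the zero section consists of one point, \<open>\<Gamma>\<^sub>0\<close>, which is where the zigzag
  ends.\<close>

lemma connected_fiber_Spec:
  "connected_nonempty (subtopology (zariski (ring_R m k I)) (fiber_Spec m k I \<gamma>))"
proof -
  let ?V = "avars m \<union> xvars k"
  let ?P = "ring_P m k :: 'k mpoly ring"
  let ?X = "{p. primeideal p ?P \<and> I \<subseteq> p \<and> p \<inter> carrier (ring_A m) = base_point m \<gamma>}"
  define p0 where "p0 = rational_point ?V (case_var \<gamma> (\<lambda>_. 0))"
  let ?z = "zero_section_point w ?V p0"
  note P = cring_mpoly_ring[of ?V]
  note I = positive_algebraD(2)
  have A: "f \<in> carrier ?P" if "f \<in> carrier (ring_A m)" for f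
    using that ring_A_subset_ring_P by blast
  have "fiber_Spec m k I \<gamma> = {q \<in> Spec (?P Quot I).
      {f \<in> carrier ?P. I +>\<^bsub>?P\<^esub> f \<in> q} \<inter> carrier (ring_A m) = base_point m \<gamma>}"
  proof -
    have "Theta m k I q = {f \<in> carrier ?P. I +>\<^bsub>?P\<^esub> f \<in> q} \<inter> carrier (ring_A m)" for q
      unfolding Theta_def Spec_map_def using A by blast
    then show ?thesis by (simp add: fiber_Spec_def ring_R_def)
  qed
  also have "\<dots> = (`) ((+>\<^bsub>?P\<^esub>) I) ` ?X"
    by (rule Spec_quot_restricted[OF P I, of "\<lambda>p. p \<inter> carrier (ring_A m) = base_point m \<gamma>"])
  finally have "fiber_Spec m k I \<gamma> = (`) ((+>\<^bsub>?P\<^esub>) I) ` ?X" .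
  moreover have "connected_nonempty (subtopology (zariski (?P Quot I)) ((`) ((+>\<^bsub>?P\<^esub>) I) ` ?X))"
  proof (rule connected_in_Spec_quot[OF P I])
    have p0: "primeideal p0 ?P" unfolding p0_def by (rule primeideal_rational_point)
    have p0A: "p0 \<inter> carrier (ring_A m) = base_point m \<gamma>"
      using A by (auto simp: p0_def base_point_def rational_point_def)
    show "?z \<in> ?X" using contraction_of_prime(1,2,3)[OF p0] p0A by simp
    fix p assume p: "p \<in> ?X"
    have "?z \<subseteq> zero_section_point w ?V p"
    proof
      fix f assume f: "f \<in> ?z"
      then have "hom_component w 0 f \<in> p0 \<inter> carrier (ring_A m)"
        using hom_component_zero_in_ring_A[OF positive_algebraD(1), of f m] by (simp add: zero_section_point_def)
      moreover have "p0 \<inter> carrier (ring_A m) = p \<inter> carrier (ring_A m)" using p p0A by simp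
      ultimately show "f \<in> zero_section_point w ?V p" using f by (simp add: zero_section_point_def)
    qed
    then show "\<exists>p\<^sub>1\<in>?X. \<exists>p\<^sub>2\<in>?X. p\<^sub>1 \<subseteq> p \<and> p\<^sub>1 \<subseteq> p\<^sub>2 \<and> ?z \<subseteq> p\<^sub>2"
      using p contraction_of_prime[of p] homogeneous_core_subset_zero_section_point[of w ?V p]
      by (intro bexI[of _ "homogeneous_core w ?V p"] bexI[of _ "zero_section_point w ?V p"]) simp_all
  qed blast
  ultimately show ?thesis by (simp only: ring_R_def)
qed

end

section \<open>The fiber in affine space\<close>

lemma mpoly_subst_const_in_carrier:
  assumes "f \<in> carrier (mpoly_ring V)" "\<And>v. v \<in> V \<Longrightarrow> s v \<in> carrier (mpoly_ring U)"
  shows "mpoly_subst mpoly_const s f \<in> carrier (mpoly_ring U)"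
proof -
  have "v \<in> V" if "\<mu> \<in> Poly_Mapping.keys f" "v \<in> Poly_Mapping.keys \<mu>" for \<mu> v
    using assms(1) that by (auto simp: mpoly_ring_def)
  then show ?thesis
    unfolding mpoly_subst_def
    by (intro mpoly_carrier_sum mpoly_carrier_mult mpoly_carrier_const mpoly_carrier_prod
        mpoly_carrier_power assms(2))
qed

abbreviation fiber_subst :: "(nat \<Rightarrow> 'k::field) \<Rightarrow> 'k mpoly \<Rightarrow> 'k mpoly" where
  "fiber_subst \<gamma> \<equiv>
     mpoly_subst mpoly_const (case_var (\<lambda>i. mpoly_const (\<gamma> i)) (\<lambda>j. mpoly_var (XVar j)))"

lemma fiber_subst_in_carrier:
  assumes "f \<in> carrier (ring_P m k)"
  shows "fiber_subst \<gamma> f \<in> carrier (ring_KX k)"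
  using assms
  by (rule mpoly_subst_const_in_carrier)
    (auto simp: avars_def xvars_def intro!: mpoly_carrier_const mpoly_carrier_var)

text \<open>Specialization of the \<open>a\<^sub>i\<close>, which have degree \<open>0\<close>, respects the grading: after homogenization both
  sides become the same substitution.\<close>

lemma hom_component_fiber_subst:
  "hom_component w d (fiber_subst \<gamma> f) = fiber_subst \<gamma> (hom_component w d f)"
proof -
  let ?s = "case_var (\<lambda>i. mpoly_const (\<gamma> i)) (\<lambda>j. mpoly_var (XVar j))"
  have c: "homogenization w (mpoly_const a) = [:mpoly_const a:]" for a :: 'a
    unfolding homogenization_def
    by (rule mpoly_subst_const[OF unital_hom_comp[OF unital_hom_pconst unital_hom_mpoly_const]])
  have "homogenization w (?s v) = monom (?s v) (var_deg w v)" for v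
  proof (cases v)
    case (AVar i)
    then show ?thesis by (simp add: c monom_0)
  next
    case (XVar j)
    show ?thesis
      unfolding XVar homogenization_def var.case
        mpoly_subst_var[OF unital_hom_comp[OF unital_hom_pconst unital_hom_mpoly_const]] ..
  qed
  then have "homogenization w (fiber_subst \<gamma> f) =
      mpoly_subst (\<lambda>a. [:mpoly_const a:]) (\<lambda>v. monom (?s v) (var_deg w v)) f"
    unfolding hom_mpoly_subst[OF unital_hom_homogenization] c by simp
  then show ?thesis
    unfolding coeff_homogenization[symmetric]
    by (simp only: coeff_graded_subst[OF unital_hom_mpoly_const] coeff_homogenization)
qed

context
  fixes m k :: nat and w :: "nat \<Rightarrow> nat" and I :: "'k::field mpoly set"
  assumes pos: "positive_algebra m k w I"
begin

lemma fiber_ideal_subset_carrier: "fiber_ideal I \<gamma> \<subseteq> carrier (ring_KX k)"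
  using positive_algebraD(3)[OF pos] fiber_subst_in_carrier[of _ m k \<gamma>]
  by (auto simp: fiber_ideal_def)

lemma fiber_ideal_homogeneous:
  "f \<in> fiber_ideal I \<gamma> \<Longrightarrow> hom_component w d f \<in> fiber_ideal I \<gamma>"
  using positive_algebraD(4)[OF pos] by (auto simp: fiber_ideal_def hom_component_fiber_subst)

text \<open>The ideal of the fiber is again homogeneous without components of degree \<open>0\<close>, so the fiber in
  affine space is a cone.\<close>

lemma connected_fiber_affine:
  "connected_nonempty (subtopology (zariski (ring_KX k)) (fiber_affine k I \<gamma>))"
  unfolding fiber_affine_def
proof (rule connected_cone[OF fiber_ideal_subset_carrier fiber_ideal_homogeneous])
  fix f assume "f \<in> fiber_ideal I \<gamma>"
  then obtain g where "g \<in> I" "f = fiber_subst \<gamma> g" by (auto simp: fiber_ideal_def)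
  then show "hom_component w 0 f = 0"
    using hom_component_zero_eq_0[OF pos]
    by (simp add: hom_component_fiber_subst) (simp add: mpoly_subst_def)
qed

end

section \<open>The monomial curve\<close>

lemma psi_alt:
  "psi w \<pi> = mpoly_subst (\<lambda>c. [:id c:]) (\<lambda>v. monom (case_var (\<lambda>_. 0) \<pi> v) (var_deg w v))"
proof -
  have "case_var (\<lambda>_. 0) (\<lambda>j. monom (\<pi> j) (w j)) =
      (\<lambda>v. monom (case_var (\<lambda>_. 0) \<pi> v) (var_deg w v))"
    by (auto simp: fun_eq_iff split: var.split)
  then show ?thesis by (simp add: psi_def)
qed

lemma unital_hom_psi: "unital_hom (psi w \<pi>)"
  unfolding psi_def by (rule unital_hom_mpoly_subst[OF unital_hom_pconst])

lemma coeff_psi: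
  "coeff (psi w \<pi> f) d = mpoly_subst id (case_var (\<lambda>_. 0) \<pi>) (hom_component w d f)"
  unfolding psi_alt by (rule coeff_graded_subst[OF unital_hom_id])

lemma psi_var: "psi w \<pi> (mpoly_var (XVar j)) = monom (\<pi> j) (w j)"
  unfolding psi_def by (simp add: mpoly_subst_var[OF unital_hom_pconst])

lemma psi_const: "psi w \<pi> (mpoly_const a) = [:a:]"
  unfolding psi_def by (rule mpoly_subst_const[OF unital_hom_pconst])

lemma poly_psi:
  "poly (psi w \<pi> f) t = mpoly_subst id (case_var (\<lambda>_. 0) (\<lambda>j. \<pi> j * t ^ w j)) f"
  unfolding psi_def hom_mpoly_subst[OF unital_hom_poly]
  by (intro arg_cong3[of _ _ _ _ _ _ mpoly_subst] refl)
    (auto simp: fun_eq_iff poly_monom split: var.split)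

lemma primeideal_psi_kernel: "primeideal (psi_kernel k w \<pi>) (ring_KX k)"
  unfolding psi_kernel_def by (rule primeideal_kernel[OF unital_hom_psi])

text \<open>The points \<open>(\<pi>\<^sub>j t^(w j))\<close> for all \<open>t\<close> in \<open>K\<close> lie on the curve; \<open>\<Pi>\<close> is the one for \<open>t = 1\<close>, for
  positive weights the zero point is the one for \<open>t = 0\<close>.\<close>

lemma psi_kernel_subset_fiber_point: "psi_kernel k w \<pi> \<subseteq> fiber_point k (\<lambda>j. \<pi> j * t ^ w j)"
  by (auto simp: psi_kernel_def fiber_point_def rational_point_def poly_psi[symmetric])

lemma psi_kernel_subset_origin:
  assumes "\<forall>j\<in>{1..k}. 0 < w j"
  shows "psi_kernel k w \<pi> \<subseteq> fiber_point k (\<lambda>_. 0)"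
proof -
  have "mpoly_subst id (case_var (\<lambda>_. 0) (\<lambda>j. \<pi> j * 0 ^ w j)) f = mpoly_subst id (case_var (\<lambda>_. 0) (\<lambda>_. 0)) f"
    if "f \<in> carrier (ring_KX k)" for f :: "'a mpoly"
    using that assms by (intro mpoly_subst_cong) (auto simp: xvars_def)
  then show ?thesis
    using psi_kernel_subset_fiber_point[of k w \<pi> 0]
    by (auto simp: fiber_point_def rational_point_def)
qed

lemma psi_kernel_psubset_origin:
  assumes "\<forall>j\<in>{1..k}. 0 < w j" "j \<in> {1..k}" "\<pi> j \<noteq> 0"
  shows "psi_kernel k w \<pi> \<subset> fiber_point k (\<lambda>_. 0)"
proof -
  have "mpoly_var (XVar j) \<in> fiber_point k (\<lambda>_. 0 :: 'a)"
    using assms(2) mpoly_carrier_var[of "XVar j" "xvars k"]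
    by (simp add: fiber_point_def rational_point_def mpoly_subst_var[OF unital_hom_id] xvars_def)
  moreover have "mpoly_var (XVar j) \<notin> psi_kernel k w \<pi>"
    using assms(3) by (simp add: psi_kernel_def psi_var monom_eq_0_iff)
  ultimately show ?thesis using psi_kernel_subset_origin[OF assms(1)] by blast
qed

text \<open>The coefficient of \<open>psi w \<pi> f\<close> at \<open>t^d\<close> is the value at \<open>\<pi>\<close> of the component of \<open>f\<close> of degree \<open>d\<close>. Hence
  the kernel of \<open>psi\<close> is the homogeneous core of the point \<open>\<pi>\<close>, and contains every homogeneous set of
  polynomials vanishing at \<open>\<pi>\<close>.\<close>

lemma homogeneous_subset_psi_kernel:
  assumes "J \<subseteq> fiber_point k \<pi>" "\<And>f d. f \<in> J \<Longrightarrow> hom_component w d f \<in> J"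
  shows "J \<subseteq> psi_kernel k w \<pi>"
proof
  fix f assume f: "f \<in> J"
  have "coeff (psi w \<pi> f) d = 0" for d
    using assms(1) assms(2)[OF f, of d] by (auto simp: coeff_psi fiber_point_def rational_point_def)
  then have "psi w \<pi> f = 0" by (simp add: poly_eq_iff)
  then show "f \<in> psi_kernel k w \<pi>"
    using f assms(1) by (auto simp: psi_kernel_def fiber_point_def rational_point_def)
qed

section \<open>The dimension of the curve\<close>

text \<open>Gaussian elimination: unless the equation \<open>e\<close> is void, solve it for an unknown \<open>i\<close> with nonzero
  coefficient and substitute into the other equations. This removes one equation and one unknown.\<close>

lemma underdetermined_system_has_solution:
  fixes a :: "'j \<Rightarrow> 'e \<Rightarrow> 'k::field"
  assumes "finite E" "finite J" "card E < card J"
  shows "\<exists>c. (\<exists>j\<in>J. c j \<noteq> 0) \<and> (\<forall>e\<in>E. (\<Sum>j\<in>J. c j * a j e) = 0)"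
  using assms
proof (induction E arbitrary: J a rule: finite_induct)
  case empty
  then have "J \<noteq> {}" by auto
  then show ?case by (intro exI[of _ "\<lambda>_. 1"]) auto
next
  case (insert e E)
  show ?case
  proof (cases "\<forall>j\<in>J. a j e = 0")
    case True
    have "card E < card J" using insert by simp
    then obtain c where "\<exists>j\<in>J. c j \<noteq> 0" "\<forall>x\<in>E. (\<Sum>j\<in>J. c j * a j x) = 0"
      using insert.IH[OF insert.prems(1)] by metis
    then show ?thesis using True by (intro exI[of _ c]) simp
  next
    case False
    then obtain i where i: "i \<in> J" "a i e \<noteq> 0" by blast
    define J' where "J' = J - {i}"
    define a' where "a' j x = a j x - a j e / a i e * a i x" for j x
    have J': "finite J'" "J = insert i J'" "i \<notin> J'" using insert.prems(1) i by (auto simp: J'_def)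
    have "card E < card J'" using insert.hyps insert.prems J' by simp
    then obtain c' where c': "\<exists>j\<in>J'. c' j \<noteq> 0" "\<forall>x\<in>E. (\<Sum>j\<in>J'. c' j * a' j x) = 0"
      using insert.IH[OF J'(1)] by metis
    define c where "c = c'(i := - (\<Sum>j\<in>J'. c' j * a j e) / a i e)"
    have "(\<Sum>j\<in>J. c j * a j x) = (\<Sum>j\<in>J'. c' j * a' j x)" for x
    proof -
      have "(\<Sum>j\<in>J. c j * a j x) = c i * a i x + (\<Sum>j\<in>J'. c' j * a j x)"
        unfolding J'(2) using J'(1,3) by (auto simp: c_def intro!: sum.cong)
      also have "c i * a i x = - (\<Sum>j\<in>J'. c' j * (a j e / a i e * a i x))"
        by (simp add: c_def sum_distrib_right sum_divide_distrib mult.assoc)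
      finally show ?thesis by (simp add: a'_def algebra_simps sum_subtractf)
    qed
    moreover have "a' j e = 0" for j using i by (simp add: a'_def)
    ultimately have "\<forall>x\<in>insert e E. (\<Sum>j\<in>J. c j * a j x) = 0" using c'(2) by simp
    moreover have "\<exists>j\<in>J. c j \<noteq> 0" using c'(1) J' by (auto simp: c_def)
    ultimately show ?thesis by blast
  qed
qed

text \<open>For a submonoid \<open>S\<close> of the natural numbers the polynomials supported on \<open>S\<close> form the monoid
  algebra \<open>K[S] \<subseteq> K[t]\<close>.\<close>

definition supported_on :: "nat set \<Rightarrow> 'k::field poly \<Rightarrow> bool" where
  "supported_on S q \<longleftrightarrow> (\<forall>i. coeff q i \<noteq> 0 \<longrightarrow> i \<in> S)"

lemma supported_on_mult:
  assumes "\<And>s t. s \<in> S \<Longrightarrow> t \<in> S \<Longrightarrow> s + t \<in> S" "supported_on S p" "supported_on S q"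
  shows "supported_on S (p * q)"
  unfolding supported_on_def
proof (intro allI impI)
  fix n assume "coeff (p * q) n \<noteq> 0"
  then obtain i where "i \<le> n" "coeff p i * coeff q (n - i) \<noteq> 0"
    unfolding coeff_mult by (meson atMost_iff sum.not_neutral_contains_not_neutral)
  then show "n \<in> S"
    using assms(1)[of i "n - i"] assms(2,3) by (auto simp: supported_on_def)
qed

text \<open>Counting dimensions shows that \<open>K[S]/(b)\<close> has dimension at most \<open>deg b\<close>: the polynomials of degree at
  most \<open>n\<close> in \<open>K[S]\<close> have the powers \<open>t^s\<close> with \<open>s \<in> S\<close>, \<open>s \<le> n\<close> as a basis, and the multiples \<open>b t^s\<close>
  with \<open>s \<le> n - deg b\<close> are at most \<open>deg b\<close> fewer. Adding the \<open>deg b + 1\<close> powers \<open>g^0, \<dots>, g^(deg b)\<close> to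
  these multiples gives more elements than the dimension allows, so there is a linear relation. It
  involves some power of \<open>g\<close>, since the \<open>b t^s\<close> are linearly independent.\<close>

lemma algebraic_modulo_principal_ideal:
  fixes b g :: "'k::field poly"
  assumes S: "0 \<in> S" "\<And>s t. s \<in> S \<Longrightarrow> t \<in> S \<Longrightarrow> s + t \<in> S"
    and b: "supported_on S b" "b \<noteq> 0" and g: "supported_on S g"
  shows "\<exists>a r. (\<exists>i\<le>degree b. a i \<noteq> 0) \<and> supported_on S r \<and>
    (\<Sum>i\<le>degree b. smult (a i) (g ^ i)) = b * r"
proof -
  \<comment> \<open>large enough for all the powers of \<open>g\<close>, and at least \<open>deg b\<close>\<close>
  define n where "n = degree b + degree g * degree b"
  define M where "M = S \<inter> {..n - degree b}"
  \<comment> \<open>\<open>Inl s\<close> stands for the multiple \<open>b t^s\<close>, \<open>Inr i\<close> for the power \<open>g^i\<close>\<close>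
  define J :: "(nat + nat) set" where "J = Inl ` M \<union> Inr ` {..degree b}"
  define F where "F = case_sum (\<lambda>s. b * monom 1 s) (\<lambda>i. g ^ i)"
  let ?E = "S \<inter> {..n}"
  have "?E \<subseteq> M \<union> {n - degree b<..n}" by (auto simp: M_def)
  then have "card ?E \<le> card (M \<union> {n - degree b<..n})"
    by (intro card_mono) (auto simp: M_def)
  also have "\<dots> \<le> card M + degree b"
    using card_Un_le[of M "{n - degree b<..n}"] by (simp add: n_def)
  also have "\<dots> < card J"
    unfolding J_def by (subst card_Un_disjoint) (auto simp: card_image M_def)
  finally have "card ?E < card J" .
  moreover have finJ: "finite J" by (simp add: J_def M_def)
  ultimately obtain c where c: "\<exists>j\<in>J. c j \<noteq> 0"
    and vanish: "\<forall>e\<in>?E. (\<Sum>j\<in>J. c j * coeff (F j) e) = 0"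
    using underdetermined_system_has_solution[of ?E J "\<lambda>j. coeff (F j)"] by auto
  have mult: "supported_on S (p * q)" if "supported_on S p" "supported_on S q" for p q :: "'k poly"
    using S(2) that by (rule supported_on_mult)
  have "supported_on S (g ^ i)" for i
  proof (induction i)
    case 0
    show ?case using S(1) by (auto simp: supported_on_def coeff_1)
  next
    case (Suc i)
    then show ?case using mult[OF g] by simp
  qed
  moreover have monom: "supported_on S (monom 1 s :: 'k poly)" if "s \<in> S" for s
    using that by (auto simp: supported_on_def)
  moreover have "supported_on S (b * monom 1 s)" if "s \<in> M" for s
  proof -
    have "s \<in> S" using that by (simp add: M_def)
    then show ?thesis by (rule mult[OF b(1) monom])
  qed
  ultimately have "supported_on S (F j)" if "j \<in> J" for j
    using that by (auto simp: J_def F_def)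
  moreover have "degree (F j) \<le> n" if "j \<in> J" for j
  proof -
    have "degree (b * monom 1 s) \<le> n" if "s \<in> M" for s
      using that degree_mult_le[of b "monom 1 s"] by (auto simp: M_def n_def degree_monom_eq)
    moreover have "degree (g ^ i) \<le> n" if "i \<le> degree b" for i
      using degree_power_le[of g i] mult_le_mono2[OF that, of "degree g"] unfolding n_def by linarith
    ultimately show ?thesis using that by (auto simp: J_def F_def)
  qed
  ultimately have F: "supported_on S (F j) \<and> degree (F j) \<le> n" if "j \<in> J" for j
    using that by blast
  have "coeff (F j) e = 0" if "j \<in> J" "e \<notin> ?E" for j e
  proof (cases "e \<in> S")
    case True
    then have "degree (F j) < e" using F[OF that(1)] that(2) by auto
    then show ?thesis by (rule coeff_eq_0)
  next
    case False
    then show ?thesis using F[OF that(1)] by (auto simp: supported_on_def)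
  qed
  then have "(\<Sum>j\<in>J. c j * coeff (F j) e) = 0" for e
    using vanish by (cases "e \<in> ?E") auto
  then have "(\<Sum>j\<in>J. smult (c j) (F j)) = 0"
    by (simp add: poly_eq_iff coeff_sum)
  moreover have "(\<Sum>j\<in>J. smult (c j) (F j)) =
      (\<Sum>s\<in>M. smult (c (Inl s)) (b * monom 1 s)) + (\<Sum>i\<le>degree b. smult (c (Inr i)) (g ^ i))"
    unfolding J_def F_def by (subst sum.union_disjoint) (auto simp: M_def sum.reindex)
  moreover define r where "r = - (\<Sum>s\<in>M. monom (c (Inl s)) s)"
  have "(\<Sum>s\<in>M. smult (c (Inl s)) (b * monom 1 s)) = - (b * r)"
    unfolding r_def by (simp add: sum_distrib_left smult_monom flip: mult_smult_right)
  ultimately have eq: "(\<Sum>i\<le>degree b. smult (c (Inr i)) (g ^ i)) = b * r" by (simp add: add_eq_0_iff)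
  have coeff_r: "coeff r s = (if s \<in> M then - c (Inl s) else 0)" for s
    by (simp add: r_def coeff_sum M_def)
  have "\<exists>i\<le>degree b. c (Inr i) \<noteq> 0"
  proof (rule ccontr)
    assume "\<not> ?thesis"
    then have no: "\<forall>i\<le>degree b. c (Inr i) = 0" by simp
    then have "b * r = 0" unfolding eq[symmetric] by simp
    then have "r = 0" using b(2) by simp
    then have "c (Inl s) = 0" if "s \<in> M" for s using coeff_r[of s] that by simp
    then show False using no c by (auto simp: J_def)
  qed
  moreover have "supported_on S r" by (auto simp: supported_on_def coeff_r M_def)
  ultimately show ?thesis using eq by (intro exI[of _ "\<lambda>i. c (Inr i)"] exI[of _ r]) auto
qed

text \<open>The image of \<open>psi\<close> is the algebra generated by monomials \<open>\<pi>\<^sub>j t^(w j)\<close>. It contains with a polynomial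
  all its terms, as these are the images of homogeneous components; so it is spanned by powers of
  \<open>t\<close>, and their exponents form a monoid.\<close>

lemma image_psi_eq_supported_on:
  fixes \<pi> :: "nat \<Rightarrow> 'k::field"
  obtains S where "0 \<in> S" "\<And>s t. s \<in> S \<Longrightarrow> t \<in> S \<Longrightarrow> s + t \<in> S"
    "psi w \<pi> ` carrier (ring_KX k) = {q. supported_on S q}"
proof -
  interpret unital_hom "psi w \<pi>" by (rule unital_hom_psi)
  let ?B = "psi w \<pi> ` carrier (ring_KX k)"
  have scale: "smult a q \<in> ?B" if q: "q \<in> ?B" for a :: 'k and q
  proof -
    obtain f where f: "f \<in> carrier (ring_KX k)" "q = psi w \<pi> f" using q by blast
    have "smult a q = psi w \<pi> (mpoly_const a * f)" by (simp add: hom_mult psi_const f(2))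
    then show ?thesis using f(1) by (blast intro: mpoly_carrier_intros)
  qed
  define S where "S = {s. monom 1 s \<in> ?B}"
  have "0 \<in> S"
    using hom_one mpoly_carrier_1[of "xvars k"] by (auto simp: S_def monom_0 one_pCons intro: rev_image_eqI)
  moreover have "s + t \<in> S" if st: "s \<in> S" "t \<in> S" for s t
  proof -
    obtain f g where fg: "f \<in> carrier (ring_KX k)" "monom 1 s = psi w \<pi> f"
      "g \<in> carrier (ring_KX k)" "monom 1 t = psi w \<pi> g"
      using st unfolding S_def by blast
    have "monom 1 (s + t) = psi w \<pi> (f * g)"
      using mult_monom[of "1 :: 'k" s 1 t] by (simp add: hom_mult fg(2,4))
    then show ?thesis using mpoly_carrier_mult[OF fg(1,3)] by (auto simp: S_def)
  qed
  moreover have "?B = {q. supported_on S q}"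
  proof (intro equalityI subsetI CollectI)
    fix q assume "q \<in> ?B"
    then obtain f where f: "f \<in> carrier (ring_KX k)" "q = psi w \<pi> f" by blast
    show "supported_on S q"
      unfolding supported_on_def
    proof (intro allI impI)
      fix i assume i: "coeff q i \<noteq> 0"
      have "psi w \<pi> (hom_component w i f) = monom (coeff q i) i"
        by (auto simp: poly_eq_iff coeff_psi hom_component_hom_component f(2)
            unital_hom.hom_zero[OF unital_hom_eval])
      then have "monom (coeff q i) i \<in> ?B"
        using hom_component_in_carrier[OF f(1)] by (metis imageI)
      then have "smult (inverse (coeff q i)) (monom (coeff q i) i) \<in> ?B" by (rule scale)
      then show "i \<in> S" using i by (simp add: S_def smult_monom)
    qed
  next
    fix q :: "'k poly" assume "q \<in> {q. supported_on S q}"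
    then have q: "i \<in> S" if "coeff q i \<noteq> 0" for i using that by (simp add: supported_on_def)
    have "\<exists>f\<in>carrier (ring_KX k). psi w \<pi> f = monom (coeff q i) i" for i
    proof (cases "coeff q i = 0")
      case True
      then show ?thesis using hom_zero mpoly_carrier_0 by force
    next
      case False
      then have "monom 1 i \<in> ?B" using q by (simp add: S_def)
      then have "smult (coeff q i) (monom 1 i) \<in> ?B" by (rule scale)
      then show ?thesis by (auto simp: smult_monom)
    qed
    then obtain f where f: "\<And>i. f i \<in> carrier (ring_KX k)" "\<And>i. psi w \<pi> (f i) = monom (coeff q i) i"
      by metis
    have "psi w \<pi> (\<Sum>i\<le>degree q. f i) = q"
      by (simp add: hom_sum f(2) poly_as_sum_of_monoms)
    then show "q \<in> ?B" using f(1) mpoly_carrier_sum by (metis imageI)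
  qed
  ultimately show ?thesis using that by blast
qed

lemma (in mpoly_prime) const_notin:
  assumes "a \<noteq> 0"
  shows "mpoly_const a \<notin> p"
proof
  assume "mpoly_const a \<in> p"
  then have "mpoly_const a * mpoly_const (inverse a) \<in> p" by (rule mult) (rule mpoly_carrier_const)
  then show False using one assms by (simp add: mpoly_const_def mult_single)
qed

text \<open>If \<open>f\<close> is algebraic over \<open>K\<close> modulo the prime \<open>p\<close>, then factors \<open>f\<close> can be cancelled from the relation
  until its constant coefficient is nonzero. That coefficient then lies in every prime above \<open>p\<close>
  containing \<open>f\<close>, which is absurd as it is a unit.\<close>

lemma (in mpoly_prime) no_larger_prime_of_algebraic:
  assumes q: "primeideal q (mpoly_ring V)" "p \<subseteq> q" and f: "f \<in> q" "f \<notin> p"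
    and "i \<le> n" "a i \<noteq> 0" "(\<Sum>i\<le>n. mpoly_const (a i) * f ^ i) \<in> p"
  shows False
  using assms(5-)
proof (induction n arbitrary: a i)
  case 0
  then show ?case using const_notin[of "a 0"] by simp
next
  case (Suc n)
  interpret q: mpoly_prime V q using q(1) by (rule mpoly_prime.intro)
  have carrier_f: "f \<in> carrier (mpoly_ring V)" by (rule q.carrier[OF f(1)])
  define y where "y = (\<Sum>i\<le>n. mpoly_const (a (Suc i)) * f ^ i)"
  have y: "y \<in> carrier (mpoly_ring V)"
    unfolding y_def by (intro mpoly_carrier_intros carrier_f)
  have eq: "(\<Sum>i\<le>Suc n. mpoly_const (a i) * f ^ i) = mpoly_const (a 0) + f * y"
    unfolding sum.atMost_Suc_shift y_def by (simp add: sum_distrib_left mult_ac)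
  show ?case
  proof (cases "a 0 = 0")
    case True
    then have "f * y \<in> p" using Suc.prems(3) unfolding eq by (simp add: mpoly_const_def)
    then have "y \<in> p" using primeD[OF carrier_f y] f(2) by blast
    moreover obtain i' where "i = Suc i'" using True Suc.prems(2) by (cases i) auto
    ultimately show False
      using Suc.IH[of i' "\<lambda>i. a (Suc i)"] Suc.prems(1,2) by (simp add: y_def)
  next
    case False
    have "mpoly_const (a 0) + f * y - f * y \<in> q"
      using Suc.prems(3) q(2) unfolding eq by (intro q.diff q.mult[OF f(1) y]) blast
    then show False using q.const_notin[OF False] by simp
  qed
qed

text \<open>If \<open>p\<close> is strictly larger than the kernel of \<open>psi\<close>, it contains some \<open>h\<close> with nonzero image \<open>b\<close>. Modulo
  \<open>b\<close> the image of any \<open>f\<close> is algebraic over \<open>K\<close>, hence \<open>f\<close> itself is algebraic modulo \<open>p\<close>, and \<open>p\<close> is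
  maximal.\<close>

lemma no_chain_above_psi_kernel:
  assumes p: "primeideal p (ring_KX k)" "psi_kernel k w \<pi> \<subset> p"
    and q: "primeideal q (ring_KX k)" "p \<subset> q"
  shows False
proof -
  interpret unital_hom "psi w \<pi>" by (rule unital_hom_psi)
  interpret p: mpoly_prime "xvars k" p using p(1) by (rule mpoly_prime.intro)
  interpret q: mpoly_prime "xvars k" q using q(1) by (rule mpoly_prime.intro)
  obtain h where h: "h \<in> p" "h \<notin> psi_kernel k w \<pi>" using p(2) by blast
  obtain f where f: "f \<in> q" "f \<notin> p" using q(2) by blast
  note carr = p.carrier[OF h(1)] q.carrier[OF f(1)]
  obtain S where S: "0 \<in> S" "\<And>s t. s \<in> S \<Longrightarrow> t \<in> S \<Longrightarrow> s + t \<in> S"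
    and B: "psi w \<pi> ` carrier (ring_KX k) = {q. supported_on S q}"
    by (rule image_psi_eq_supported_on[of w \<pi> k]) blast
  have "supported_on S (psi w \<pi> h)" "supported_on S (psi w \<pi> f)"
    using B carr by blast+
  moreover have "psi w \<pi> h \<noteq> 0" using h(2) carr(1) by (simp add: psi_kernel_def)
  ultimately have "\<exists>a r. (\<exists>i\<le>degree (psi w \<pi> h). a i \<noteq> 0) \<and> supported_on S r \<and>
      (\<Sum>i\<le>degree (psi w \<pi> h). smult (a i) (psi w \<pi> f ^ i)) = psi w \<pi> h * r"
    using S by (intro algebraic_modulo_principal_ideal)
  then obtain a r where a: "\<exists>i\<le>degree (psi w \<pi> h). a i \<noteq> 0" and r: "supported_on S r"
    and eq: "(\<Sum>i\<le>degree (psi w \<pi> h). smult (a i) (psi w \<pi> f ^ i)) = psi w \<pi> h * r"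
    by blast
  obtain r' where r': "r' \<in> carrier (ring_KX k)" "r = psi w \<pi> r'" using B r by blast
  define y where "y = (\<Sum>i\<le>degree (psi w \<pi> h). mpoly_const (a i) * f ^ i)"
  have y: "y \<in> carrier (ring_KX k)"
    unfolding y_def by (intro mpoly_carrier_intros carr)
  have "psi w \<pi> y = psi w \<pi> (h * r')"
    by (simp add: y_def hom_sum hom_mult hom_power psi_const eq r'(2))
  then have "psi w \<pi> (y + mpoly_const (- 1) * (h * r')) = 0"
    by (simp add: hom_add hom_mult psi_const)
  then have "y + mpoly_const (- 1) * (h * r') \<in> psi_kernel k w \<pi>"
    using y r'(1) carr(1) by (simp add: psi_kernel_def mpoly_carrier_intros)
  then have "y + mpoly_const (- 1) * (h * r') \<in> p" using p(2) by blast
  moreover have "mpoly_const (- 1) * (h * r') \<in> p"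
    using p.mult'[OF p.mult[OF h(1) r'(1)] mpoly_carrier_const] .
  ultimately have "y \<in> p" using p.diff by force
  then show False
    using a p.no_larger_prime_of_algebraic[OF q(1) _ f] q(2) unfolding y_def by blast
qed

text \<open>The chain of length one consists of the zero point and the whole curve. They differ because
  \<open>\<pi>\<^sub>j \<noteq> 0\<close>: the coordinate \<open>x\<^sub>j\<close> vanishes at the former but not on the latter.\<close>

lemma irreducible_curve_curve:
  assumes "\<forall>j\<in>{1..k}. 0 < w j" "j \<in> {1..k}" "\<pi> j \<noteq> 0"
  shows "irreducible_curve (zariski (ring_KX k)) (curve k w \<pi>)"
proof -
  have "primeideal (fiber_point k (\<lambda>_. 0)) (ring_KX k)"
    unfolding fiber_point_def by (rule primeideal_rational_point)
  then have "krull_dim (subtopology (zariski (ring_KX k)) (curve k w \<pi>)) = 1"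
    unfolding curve_def
    using psi_kernel_psubset_origin[where \<pi> = \<pi>, OF assms] no_chain_above_psi_kernel
    by (intro krull_dim_zero_locus_eq_1 cring_mpoly_ring primeideal_psi_kernel)
  then show ?thesis
    using irreducible_zero_locus[OF primeideal_psi_kernel[of k w \<pi>]]
    by (simp add: irreducible_curve_def curve_def)
qed

theorem proposition3p1:
  fixes m k :: nat and w :: "nat \<Rightarrow> nat" and I :: "'k::field mpoly set"
  assumes "positive_algebra m k w I"
  shows
    "(\<forall>\<gamma> \<pi> :: nat \<Rightarrow> 'k.
        fiber_point k \<pi> \<in> fiber_affine k I \<gamma> \<longrightarrow> (\<exists>j\<in>{1..k}. \<pi> j \<noteq> 0) \<longrightarrow>
          ideal (psi_kernel k w \<pi>) (ring_KX k) \<and>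
          irreducible_curve (zariski (ring_KX k)) (curve k w \<pi>) \<and>
          fiber_ideal I \<gamma> \<subseteq> psi_kernel k w \<pi> \<and> curve k w \<pi> \<subseteq> fiber_affine k I \<gamma> \<and>
          fiber_point k \<pi> \<in> curve k w \<pi> \<and> fiber_point k (\<lambda>_. 0) \<in> curve k w \<pi>) \<and>
     (\<forall>\<gamma> :: nat \<Rightarrow> 'k.
        connected_nonempty (subtopology (zariski (ring_R m k I)) (fiber_Spec m k I \<gamma>)) \<and>
        connected_nonempty (subtopology (zariski (ring_KX k)) (fiber_affine k I \<gamma>))) \<and>
     connected_nonempty (zariski (ring_R m k I))"
proof (intro conjI allI impI)
  fix \<gamma> \<pi> :: "nat \<Rightarrow> 'k"
  assume \<pi>: "fiber_point k \<pi> \<in> fiber_affine k I \<gamma>" and nz: "\<exists>j\<in>{1..k}. \<pi> j \<noteq> 0"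
  note w = positive_algebraD(1)[OF assms]
  obtain j where j: "j \<in> {1..k}" "\<pi> j \<noteq> 0" using nz by blast
  show "ideal (psi_kernel k w \<pi>) (ring_KX k)"
    using primeideal_psi_kernel by (rule primeideal.axioms(1))
  show "irreducible_curve (zariski (ring_KX k)) (curve k w \<pi>)"
    by (rule irreducible_curve_curve[where \<pi> = \<pi>, OF w j])
  have "fiber_ideal I \<gamma> \<subseteq> fiber_point k \<pi>"
    using \<pi> by (simp add: fiber_affine_def zero_locus_def)
  then show "fiber_ideal I \<gamma> \<subseteq> psi_kernel k w \<pi>"
    by (rule homogeneous_subset_psi_kernel) (rule fiber_ideal_homogeneous[OF assms])
  then show "curve k w \<pi> \<subseteq> fiber_affine k I \<gamma>"
    by (auto simp: curve_def fiber_affine_def zero_locus_def)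
  have point: "fiber_point k c \<in> Spec (ring_KX k)" for c :: "nat \<Rightarrow> 'k"
    by (simp add: Spec_def fiber_point_def primeideal_rational_point)
  show "fiber_point k \<pi> \<in> curve k w \<pi>"
    using psi_kernel_subset_fiber_point[of k w \<pi> 1] point
    by (simp add: curve_def zero_locus_def)
  show "fiber_point k (\<lambda>_. 0) \<in> curve k w \<pi>"
    using psi_kernel_subset_origin[OF w] point by (simp add: curve_def zero_locus_def)
next
  fix \<gamma> :: "nat \<Rightarrow> 'k"
  show "connected_nonempty (subtopology (zariski (ring_R m k I)) (fiber_Spec m k I \<gamma>))"
    by (rule connected_fiber_Spec[OF assms])
  show "connected_nonempty (subtopology (zariski (ring_KX k)) (fiber_affine k I \<gamma>))"
    by (rule connected_fiber_affine[OF assms])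
next
  show "connected_nonempty (zariski (ring_R m k I))"
    by (rule connected_Spec_ring_R[OF assms])
qed

end
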